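(* Let $D_{FP}:\mathcal F_c(\mathbb R^p)\times L^0[\mathcal F_c(\mathbb R^p)]\to[0,\infty)$ be the projection depth for fuzzy sets. Then the following hold. (P1) $D_{FP}(M\cdot U+V;\,M\cdot\mathcal X+V)=D_{FP}(U;\mathcal X)$ for every regular (invertible) matrix $M\in\mathcal M_{p\times p}(\mathbb R)$, all $U,V\in\mathcal F_c(\mathbb R^p)$ and every $\mathcal X\in L^0[\mathcal F_c(\mathbb R^p)]$. (P2 with $F$-symmetry) If $\mathcal X\in L^0[\mathcal F_c(\mathbb R^p)]$ is $F$-symmetric with respect to $U\in\mathcal F_c(\mathbb R^p)$, then $D_{FP}(U;\mathcal X)=\sup_{B\in\mathcal F_c(\mathbb R^p)}D_{FP}(B;\mathcal X)$. Moreover, for every $\mathcal X\in L^0[\mathcal F_c(\mathbb R^p)]$ and every $A\in\mathcal F_c(\mathbb R^p)$ such that $D_{FP}(A;\mathcal X)=\sup_{B\in\mathcal F_c(\mathbb R^p)}D_{FP}(B;\mathcal X)$: (P3a) $D_{FP}(A;\mathcal X)\ge D_{FP}((1-\lambda)\cdot A+\lambda\cdot U;\mathcal X)\ge D_{FP}(U;\mathcal X)$ for all $\lambda\in[0,1]$ and all $U\in\mathcal F_c(\mathbb R^p)$. (P4a) $\lim_{\lambda\to\infty}D_{FP}(A+\lambda\cdot U;\mathcal X)=0$ for all $U\in\mathcal F_c(\mathbb R^p)\setminus\{\mathrm I_{\{0\}}\}$. (P3b for $\rho_r$, $r\in(1,\infty)$) For every $r\in(1,\infty)$, $D_{FP}(A;\mathcal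 X)\ge D_{FP}(U;\mathcal X)\ge D_{FP}(V;\mathcal X)$ for all $U,V\in\mathcal F_c(\mathbb R^p)$ with $\rho_r(A,V)=\rho_r(A,U)+\rho_r(U,V)$. (P4b for $\rho_r$, $r\in[1,\infty)$, and for $d_r$, $r\in[1,\infty]$) If $d=\rho_r$ with $r\in[1,\infty)$ or $d=d_r$ with $r\in[1,\infty]$, then $\lim_{n\to\infty}D_{FP}(A_n;\mathcal X)=0$ for every sequence $\{A_n\}_n$ in $\mathcal F_c(\mathbb R^p)$ with $d(A_n,A)\to\infty$.
   Context: Fix an integer $p\ge1$; $\mathbb S^{p-1}=\{u\in\mathbb R^p:\|u\|=1\}$ with $\|\cdot\|$ the Euclidean norm. For $A:\mathbb R^p\to[0,1]$ the $\alpha$-levels are $A_\alpha=\{x:A(x)\ge\alpha\}$ for $\alpha\in(0,1]$, and $A_0$ is the closure of $\{x:A(x)>0\}$. $\mathcal F_c(\mathbb R^p)$ is the set of all $A:\mathbb R^p\to[0,1]$ such that $A_\alpha$ is non-empty, compact and convex for each $\alpha\in[0,1]$ (called fuzzy sets). $\mathcal K_c(\mathbb R^p)$ is the class of non-empty compact convex subsets of $\mathbb R^p$, and $\mathrm I_K$ is the indicator function of $K$. The support function of $A$ is $s_A(u,\alpha)=\sup_{v\in A_\alpha}\langle u,v\rangle$, $(u,\alpha)\in\mathbb S^{p-1}\times[0,1]$. Operations: $(A+B)(t)=\sup_{x+y=t}\min\{A(x),B(y)\}$; for $\gamma\in\mathbb R$, $(\gamma\cdot A)(t)=\sup\{A(x):\gamma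 x=t\}$, so that $0\cdot A=\mathrm I_{\{0\}}$; for an invertible matrix $M$, $(M\cdot A)(t)=\sup\{A(y):My=t\}$. Metrics: with $d_H$ the Hausdorff metric on $\mathcal K_c(\mathbb R^p)$, $\nu$ the Lebesgue measure on $[0,1]$ and $\mathcal V_p$ the normalized Haar (uniform probability) measure on $\mathbb S^{p-1}$, $d_r(A,B)=\left(\int_{[0,1]}d_H(A_\alpha,B_\alpha)^r\,d\nu(\alpha)\right)^{1/r}$ for $r\in[1,\infty)$, $d_\infty(A,B)=\sup_{\alpha\in[0,1]}d_H(A_\alpha,B_\alpha)$, and $\rho_r(A,B)=\left(\int_{[0,1]}\int_{\mathbb S^{p-1}}|s_A(u,\alpha)-s_B(u,\alpha)|^r\,d\mathcal V_p(u)\,d\nu(\alpha)\right)^{1/r}$ for $r\in[1,\infty)$. Fuzzy random variables: given a probability space $(\Omega,\mathcal A,\mathbb P)$, a map $\mathcal X:\Omega\to\mathcal F_c(\mathbb R^p)$ is a fuzzy random variable if for every $\alpha\in[0,1]$ the map $\omega\mapsto\mathcal X(\omega)_\alpha\in\mathcal K_c(\mathbb R^p)$ is Borel measurable with respect to $d_H$. $L^0[\mathcal F_c(\mathbb R^p)]$ is the class of all of them. $s_{\mathcal X}(u,\alpha)$ denotes the real random variable $\omega\mapsto s_{\mathcal X(\omega)}(u,\alpha)$. $M\cdot\mathcal X+V$ is defined pointwise in $\omega$. $\mathcal X$ is $F$-symmetric with respect to $A\in\mathcal F_c(\mathbb R^p)$ if, for all $(u,\alpha)\in\mathbb S^{p-1}\times[0,1]$,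 the random variables $s_A(u,\alpha)-s_{\mathcal X}(u,\alpha)$ and $s_{\mathcal X}(u,\alpha)-s_A(u,\alpha)$ are equal in distribution. Projection depth: for a real random variable $Y$, $\mathrm{med}(Y)$ is the midpoint of the interval of all medians of $Y$, and $\mathrm{MAD}(Y)=\mathrm{med}(|Y-\mathrm{med}(Y)|)$. Define $$D_{FP}(A;\mathcal X)=(1+O(A;\mathcal X))^{-1},\qquad O(A;\mathcal X)=\sup_{u\in\mathbb S^{p-1},\,\alpha\in[0,1]}\frac{|s_A(u,\alpha)-\mathrm{med}(s_{\mathcal X}(u,\alpha))|}{\mathrm{MAD}(s_{\mathcal X}(u,\alpha))},$$ with $O(A;\mathcal X)\in[0,\infty]$, the conventions $0/0=0$, $a/0=\infty$ for $a>0$, and $(1+\infty)^{-1}=0$. *)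

theory Defs
  imports "HOL-Probability.Probability"
begin

(* Meaningful for alpha in [0,1] only. *)
definition level :: "((real^'n) \<Rightarrow> real) \<Rightarrow> real \<Rightarrow> (real^'n) set" where
  "level A \<alpha> = (if \<alpha> = 0 then closure {x. A x > 0} else {x. A x \<ge> \<alpha>})"

definition convex_bodies :: "(real^'n) set set" where
  "convex_bodies = {K. K \<noteq> {} \<and> compact K \<and> convex K}"

definition fuzzy_sets :: "((real^'n) \<Rightarrow> real) set" where
  "fuzzy_sets = {A. (\<forall>x. A x \<in> {0..1}) \<and> (\<forall>\<alpha>\<in>{0..1}. level A \<alpha> \<in> convex_bodies)}"

definition support_fun :: "((real^'n) \<Rightarrow> real) \<Rightarrow> real^'n \<Rightarrow> real \<Rightarrow> real" where
  "support_fun A u \<alpha> = (SUP v\<in>level A \<alpha>. u \<bullet> v)"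

(* Supremum in the complete lattice [0,1]; in particular the supremum of the empty set is 0,
   whereas the conditionally complete Sup of type real is unspecified there. *)
definition sup01 :: "real set \<Rightarrow> real" where
  "sup01 S = Sup (insert 0 S)"

definition fuzzy_add :: "((real^'n) \<Rightarrow> real) \<Rightarrow> ((real^'n) \<Rightarrow> real) \<Rightarrow> (real^'n) \<Rightarrow> real" where
  "fuzzy_add A B t = sup01 {min (A x) (B y) | x y. x + y = t}"

definition fuzzy_scale :: "real \<Rightarrow> ((real^'n) \<Rightarrow> real) \<Rightarrow> (real^'n) \<Rightarrow> real" where
  "fuzzy_scale \<gamma> A t = sup01 {A x | x. \<gamma> *\<^sub>R x = t}"

definition fuzzy_matrix :: "real^'n^'n \<Rightarrow> ((real^'n) \<Rightarrow> real) \<Rightarrow> (real^'n) \<Rightarrow> real" where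
  "fuzzy_matrix M A t = sup01 {A y | y. M *v y = t}"

(* The guard always holds on convex_bodies; it makes the distance nonnegative on all pairs of sets,
   which the locale Metric_space asks for. *)
definition hausdorff_dist :: "(real^'n) set \<Rightarrow> (real^'n) set \<Rightarrow> real" where
  "hausdorff_dist K L =
     (if K \<noteq> {} \<and> L \<noteq> {} \<and> bounded K \<and> bounded L
      then max (SUP x\<in>K. infdist x L) (SUP y\<in>L. infdist y K) else 0)"

(* The normalized Haar measure on the unit sphere, realized as the distribution of x / |x| for x
   uniform in the unit ball; sgn x = x / |x| for x \<noteq> 0. See sphere_measure_prob_space and
   sphere_measure_orthogonal below. *)
definition sphere_measure :: "(real^'n) measure" where
  "sphere_measure =
     restrict_space (distr (uniform_measure lborel (ball 0 1)) borel sgn) (sphere 0 1)"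

definition d_metric :: "real \<Rightarrow> ((real^'n) \<Rightarrow> real) \<Rightarrow> ((real^'n) \<Rightarrow> real) \<Rightarrow> real" where
  "d_metric r A B =
     (LINT \<alpha>:{0..1}|lborel. hausdorff_dist (level A \<alpha>) (level B \<alpha>) powr r) powr (1 / r)"

definition d_metric_inf :: "((real^'n) \<Rightarrow> real) \<Rightarrow> ((real^'n) \<Rightarrow> real) \<Rightarrow> real" where
  "d_metric_inf A B = (SUP \<alpha>\<in>{0..1}. hausdorff_dist (level A \<alpha>) (level B \<alpha>))"

definition rho_metric :: "real \<Rightarrow> ((real^'n) \<Rightarrow> real) \<Rightarrow> ((real^'n) \<Rightarrow> real) \<Rightarrow> real" where
  "rho_metric r A B =
     (LINT \<alpha>:{0..1}|lborel.
        (LINT u|sphere_measure. \<bar>support_fun A u \<alpha> - support_fun B u \<alpha>\<bar> powr r)) powr (1 / r)"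

definition convex_bodies_borel :: "(real^'n) set measure" where
  "convex_bodies_borel =
     sigma convex_bodies {S. openin (Metric_space.mtopology convex_bodies hausdorff_dist) S}"

definition fuzzy_random_variables :: "'w measure \<Rightarrow> ('w \<Rightarrow> (real^'n) \<Rightarrow> real) set" where
  "fuzzy_random_variables P =
     {X. (\<forall>\<omega>\<in>space P. X \<omega> \<in> fuzzy_sets) \<and>
         (\<forall>\<alpha>\<in>{0..1}. (\<lambda>\<omega>. level (X \<omega>) \<alpha>) \<in> measurable P convex_bodies_borel)}"

definition F_symmetric ::
    "'w measure \<Rightarrow> ('w \<Rightarrow> (real^'n) \<Rightarrow> real) \<Rightarrow> ((real^'n) \<Rightarrow> real) \<Rightarrow> bool" where
  "F_symmetric P X A \<longleftrightarrow>
     (\<forall>u\<in>sphere 0 1. \<forall>\<alpha>\<in>{0..1}.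
        distr P borel (\<lambda>\<omega>. support_fun A u \<alpha> - support_fun (X \<omega>) u \<alpha>) =
        distr P borel (\<lambda>\<omega>. support_fun (X \<omega>) u \<alpha> - support_fun A u \<alpha>))"

definition medians :: "'w measure \<Rightarrow> ('w \<Rightarrow> real) \<Rightarrow> real set" where
  "medians P Y = {m. measure P {\<omega>\<in>space P. Y \<omega> \<le> m} \<ge> 1 / 2 \<and>
                     measure P {\<omega>\<in>space P. Y \<omega> \<ge> m} \<ge> 1 / 2}"

definition med :: "'w measure \<Rightarrow> ('w \<Rightarrow> real) \<Rightarrow> real" where
  "med P Y = (Inf (medians P Y) + Sup (medians P Y)) / 2"

definition MAD :: "'w measure \<Rightarrow> ('w \<Rightarrow> real) \<Rightarrow> real" where
  "MAD P Y = med P (\<lambda>\<omega>. \<bar>Y \<omega> - med P Y\<bar>)"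

(* Division and inverse on ennreal satisfy 0 / 0 = 0, a / 0 = top for a > 0, and inverse top = 0,
   which are exactly the conventions required here; see ennreal_conventions below. *)
definition outlyingness ::
    "'w measure \<Rightarrow> ((real^'n) \<Rightarrow> real) \<Rightarrow> ('w \<Rightarrow> (real^'n) \<Rightarrow> real) \<Rightarrow> ennreal" where
  "outlyingness P A X =
     (SUP (u, \<alpha>)\<in>sphere 0 1 \<times> {0..1}.
        ennreal \<bar>support_fun A u \<alpha> - med P (\<lambda>\<omega>. support_fun (X \<omega>) u \<alpha>)\<bar> /
        ennreal (MAD P (\<lambda>\<omega>. support_fun (X \<omega>) u \<alpha>)))"

definition D_FP ::
    "'w measure \<Rightarrow> ((real^'n) \<Rightarrow> real) \<Rightarrow> ('w \<Rightarrow> (real^'n) \<Rightarrow> real) \<Rightarrow> real" where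
  "D_FP P A X = enn2real (inverse (1 + outlyingness P A X))"

lemma ennreal_conventions:
  "(0::ennreal) / 0 = 0"
  "a > 0 \<Longrightarrow> (a::ennreal) / 0 = top"
  "inverse (1 + top :: ennreal) = 0"
  by (auto simp: divide_ennreal_def ennreal_mult_top)

lemma D_FP_bounds: "0 \<le> D_FP P A X" "D_FP P A X \<le> 1"
proof -
  have "1 / (1 + outlyingness P A X) \<le> 1"
    by (rule divide_le_posI_ennreal) (auto simp: add_pos_nonneg)
  then have "inverse (1 + outlyingness P A X) \<le> 1" by (simp add: divide_ennreal_def)
  then show "D_FP P A X \<le> 1"
    unfolding D_FP_def by (metis enn2real_1 enn2real_mono ennreal_one_less_top)
qed (simp add: D_FP_def)

lemma hausdorff_dist_convex_bodies:
  assumes "K \<in> convex_bodies" "L \<in> convex_bodies"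
  shows "hausdorff_dist K L = max (SUP x\<in>K. infdist x L) (SUP y\<in>L. infdist y K)"
  using assms by (simp add: hausdorff_dist_def convex_bodies_def compact_imp_bounded)

lemma Metric_space_convex_bodies:
  "Metric_space (convex_bodies :: (real^'n) set set) hausdorff_dist"
proof -
  have bdd: "bdd_above ((\<lambda>x. infdist x L) ` K)" if K: "bounded K" for K L :: "(real^'n) set"
  proof -
    have "bounded ((\<lambda>x. infdist x L) ` closure K)"
      using K by (intro compact_imp_bounded compact_continuous_image continuous_intros)
        (simp add: compact_closure)
    then show ?thesis
      by (meson bounded_imp_bdd_above bounded_subset closure_subset image_mono)
  qed
  have ge1: "infdist x L \<le> (SUP x\<in>K. infdist x L)" if "bounded K" "x \<in> K"
    for x and K L :: "(real^'n) set"
    using cSUP_upper[OF that(2) bdd[OF that(1)]] .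
  have le: "infdist x L \<le> hausdorff_dist K L"
    if "K \<in> convex_bodies" "L \<in> convex_bodies" "x \<in> K" for x and K L :: "(real^'n) set"
    using that ge1[of K x L]
    by (auto simp: hausdorff_dist_convex_bodies le_max_iff_disj convex_bodies_def
        dest: compact_imp_bounded)
  have sym: "hausdorff_dist K L = hausdorff_dist L K" for K L :: "(real^'n) set"
    by (auto simp: hausdorff_dist_def max.commute)
  have sub: "K \<subseteq> L" if "K \<in> convex_bodies" "L \<in> convex_bodies" "hausdorff_dist K L = 0"
    for K L :: "(real^'n) set"
  proof
    fix x assume "x \<in> K"
    with le[of K L x] that have "infdist x L = 0" using infdist_nonneg[of x L] by linarith
    with that show "x \<in> L"
      by (auto simp: convex_bodies_def in_closed_iff_infdist_zero compact_imp_closed)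
  qed
  have tri: "infdist x N \<le> hausdorff_dist K L + hausdorff_dist L N"
    if "K \<in> convex_bodies" "L \<in> convex_bodies" "N \<in> convex_bodies" "x \<in> K"
    for x and K L N :: "(real^'n) set"
  proof -
    have "closed L" "L \<noteq> {}" using that by (auto simp: convex_bodies_def compact_imp_closed)
    from infdist_attains_inf[OF this]
    obtain y where y: "y \<in> L" "infdist x L = dist x y" by blast
    have "infdist x N \<le> infdist y N + dist x y" by (rule infdist_triangle)
    also have "\<dots> \<le> hausdorff_dist L N + hausdorff_dist K L"
      using le[of L N y] le[of K L x] y that by simp
    finally show ?thesis by simp
  qed
  show ?thesis
  proof
    fix K L N :: "(real^'n) set"
    show "0 \<le> hausdorff_dist K L"
    proof (cases "K \<noteq> {} \<and> L \<noteq> {} \<and> bounded K \<and> bounded L")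
      case True
      then obtain x where "x \<in> K" by blast
      then have "0 \<le> (SUP x\<in>K. infdist x L)"
        using ge1[of K x L] True infdist_nonneg[of x L] by linarith
      then show ?thesis by (simp add: hausdorff_dist_def le_max_iff_disj)
    qed (auto simp: hausdorff_dist_def)
    show "hausdorff_dist K L = hausdorff_dist L K" by (rule sym)
    show "(hausdorff_dist K L = 0) = (K = L)" if KL: "K \<in> convex_bodies" "L \<in> convex_bodies"
    proof
      assume "hausdorff_dist K L = 0"
      then show "K = L" using sub[of K L] sub[of L K] KL sym[of K L] by auto
    next
      assume "K = L"
      with KL show "hausdorff_dist K L = 0"
        by (auto simp: hausdorff_dist_convex_bodies convex_bodies_def)
    qed
    show "hausdorff_dist K N \<le> hausdorff_dist K L + hausdorff_dist L N"
      if KLN: "K \<in> convex_bodies" "L \<in> convex_bodies" "N \<in> convex_bodies"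
    proof -
      have "(SUP x\<in>K. infdist x N) \<le> hausdorff_dist K L + hausdorff_dist L N"
        using KLN tri[OF KLN] by (intro cSUP_least) (auto simp: convex_bodies_def)
      moreover have "infdist x K \<le> hausdorff_dist K L + hausdorff_dist L N" if "x \<in> N" for x
        using tri[OF KLN(3,2,1) that] sym[of N L] sym[of L K] by simp
      then have "(SUP x\<in>N. infdist x K) \<le> hausdorff_dist K L + hausdorff_dist L N"
        using KLN by (intro cSUP_least) (auto simp: convex_bodies_def)
      ultimately show ?thesis using KLN by (simp add: hausdorff_dist_convex_bodies[of K N])
    qed
  qed
qed

lemma sphere_measure_prob_space: "prob_space (sphere_measure :: (real^'n) measure)"
proof -
  let ?U = "uniform_measure lborel (ball 0 1) :: (real^'n) measure"
  have B: "emeasure lborel (ball 0 1 :: (real^'n) set) \<noteq> 0"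
    using unit_ball_vol_pos[of "real CARD('n)"] by (simp add: emeasure_ball del: unit_ball_vol_pos)
  have B': "emeasure lborel (ball 0 1 :: (real^'n) set) \<noteq> \<infinity>"
    using emeasure_lborel_ball_finite[of "0::real^'n" 1] by (auto simp: less_top)
  interpret U: prob_space ?U by (rule prob_space_uniform_measure[OF B B'])
  have sgn_m: "sgn \<in> borel_measurable (borel :: (real^'n) measure)"
    unfolding sgn_div_norm by measurable
  have S: "sphere 0 1 \<in> sets (borel :: (real^'n) measure)" by simp
  have "emeasure ?U {0} \<le> 0"
    by (subst emeasure_uniform_measure) (auto intro!: emeasure_mono[where b="{0}", THEN order_trans])
  then have "AE x in ?U. x \<noteq> 0"
    by (intro AE_I[where N="{0}"]) auto
  then have ae: "AE x in ?U. x \<in> sgn -` sphere 0 1" by eventually_elim (auto simp: norm_sgn)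
  have "emeasure (distr ?U borel sgn) (sphere 0 1) = emeasure ?U (sgn -` sphere 0 1)"
    using sgn_m by (subst emeasure_distr[OF _ S]) auto
  also have "\<dots> = 1"
    by (rule U.emeasure_eq_1_AE[OF _ ae]) (use measurable_sets[OF sgn_m S] in simp)
  finally show ?thesis
    unfolding sphere_measure_def
    by (intro prob_spaceI) (simp add: space_restrict_space emeasure_restrict_space)
qed

lemma lborel_distr_orthogonal:
  fixes T :: "real^'n \<Rightarrow> real^'n"
  assumes T: "orthogonal_transformation T"
  shows "distr lborel borel T = lborel"
proof (rule measure_eqI)
  have lin: "linear T" and nT: "norm (T x) = norm x" for x
    using T by (auto simp: orthogonal_transformation)
  have T_m[measurable]: "T \<in> borel_measurable borel"
    using lin by (intro borel_measurable_continuous_onI linear_continuous_on)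
      (simp add: linear_conv_bounded_linear)
  define S where "S = inv T"
  have TS: "T (S y) = y" for y
    unfolding S_def using orthogonal_transformation_surj[OF T] by (simp add: surj_f_inv_f)
  define b where "b = emeasure lborel (ball 0 1 :: (real^'n) set)"
  have b: "b \<noteq> 0" "b \<noteq> top"
    using unit_ball_vol_pos[of "real CARD('n)"] emeasure_lborel_ball_finite[of "0::real^'n" 1]
    by (auto simp: b_def emeasure_ball less_top simp del: unit_ball_vol_pos)
  have shift: "(\<integral>\<^sup>+x. f (c + x) \<partial>lborel) = (\<integral>\<^sup>+x. f x \<partial>lborel)"
    if [measurable]: "f \<in> borel_measurable borel" for f :: "real^'n \<Rightarrow> ennreal" and c
    by (subst (2) lborel_distr_plus[of c, symmetric], subst nn_integral_distr) auto
  fix A :: "(real^'n) set" assume "A \<in> sets (distr lborel borel T)"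
  then have A[measurable]: "A \<in> sets borel" by simp
  have ball_m[measurable]: "ball 0 1 \<in> sets (borel :: (real^'n) measure)" by simp
  let ?f = "indicator A :: real^'n \<Rightarrow> ennreal"
  let ?g = "indicator (ball 0 1) :: real^'n \<Rightarrow> ennreal"
  have "emeasure (distr lborel borel T) A * b = (\<integral>\<^sup>+x. ?f (T x) \<partial>lborel) * (\<integral>\<^sup>+y. ?g y \<partial>lborel)"
  proof -
    have "emeasure (distr lborel borel T) A = (\<integral>\<^sup>+x. ?f x \<partial>distr lborel borel T)"
      by simp
    also have "\<dots> = (\<integral>\<^sup>+x. ?f (T x) \<partial>lborel)"
      by (rule nn_integral_distr) auto
    finally show ?thesis by (simp add: b_def)
  qed
  also have "\<dots> = (\<integral>\<^sup>+y. (\<integral>\<^sup>+x. ?f (T x) \<partial>lborel) * ?g y \<partial>lborel)"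
    by (rule nn_integral_cmult[symmetric]) measurable
  also have "\<dots> = (\<integral>\<^sup>+y. (\<integral>\<^sup>+x. ?f (T x + y) * ?g y \<partial>lborel) \<partial>lborel)"
  proof (rule nn_integral_cong)
    fix y :: "real^'n"
    have "(\<integral>\<^sup>+x. ?f (T x) \<partial>lborel) = (\<integral>\<^sup>+x. ?f (T (S y + x)) \<partial>lborel)"
      by (rule shift[symmetric]) measurable
    also have "\<dots> = (\<integral>\<^sup>+x. ?f (T x + y) \<partial>lborel)"
      by (simp add: linear_add[OF lin] TS add.commute)
    finally show "(\<integral>\<^sup>+x. ?f (T x) \<partial>lborel) * ?g y = (\<integral>\<^sup>+x. ?f (T x + y) * ?g y \<partial>lborel)"
      by (simp add: nn_integral_multc)
  qed
  also have "\<dots> = (\<integral>\<^sup>+x. (\<integral>\<^sup>+y. ?f (T x + y) * ?g y \<partial>lborel) \<partial>lborel)"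
    by (rule lborel_pair.Fubini') measurable
  also have "\<dots> = (\<integral>\<^sup>+x. (\<integral>\<^sup>+z. ?f z * ?g (z - T x) \<partial>lborel) \<partial>lborel)"
  proof (rule nn_integral_cong)
    fix x :: "real^'n"
    show "(\<integral>\<^sup>+y. ?f (T x + y) * ?g y \<partial>lborel) = (\<integral>\<^sup>+z. ?f z * ?g (z - T x) \<partial>lborel)"
      using shift[of "\<lambda>z. ?f z * ?g (z - T x)" "T x"] by simp
  qed
  also have "\<dots> = (\<integral>\<^sup>+z. (\<integral>\<^sup>+x. ?f z * ?g (z - T x) \<partial>lborel) \<partial>lborel)"
    by (rule lborel_pair.Fubini') measurable
  also have "\<dots> = (\<integral>\<^sup>+z. ?f z * b \<partial>lborel)"
  proof (rule nn_integral_cong)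
    fix z :: "real^'n"
    have "?g (z - T x) = indicator (ball (S z) 1) x" for x
    proof -
      have "norm (z - T x) = norm (S z - x)"
        using nT[of "S z - x"] by (simp add: linear_diff[OF lin] TS)
      then show ?thesis by (simp add: indicator_def norm_minus_commute[of "T x"] dist_norm)
    qed
    then have "(\<integral>\<^sup>+x. ?g (z - T x) \<partial>lborel) = b"
      by (simp add: b_def emeasure_ball)
    then show "(\<integral>\<^sup>+x. ?f z * ?g (z - T x) \<partial>lborel) = ?f z * b"
      by (subst nn_integral_cmult) auto
  qed
  also have "\<dots> = emeasure lborel A * b"
    by (simp add: nn_integral_multc)
  finally show "emeasure (distr lborel borel T) A = emeasure lborel A"
    using b by (metis ennreal_mult_divide_eq)
qed simp

lemma sphere_measure_orthogonal:
  fixes T :: "real^'n \<Rightarrow> real^'n"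
  assumes T: "orthogonal_transformation T"
  shows "distr sphere_measure sphere_measure T = sphere_measure"
proof (rule measure_eqI)
  let ?U = "uniform_measure lborel (ball 0 1) :: (real^'n) measure"
  have lin: "linear T" and nT: "norm (T x) = norm x" for x
    using T by (auto simp: orthogonal_transformation)
  have T_m[measurable]: "T \<in> borel_measurable borel"
    using lin by (intro borel_measurable_continuous_onI linear_continuous_on)
      (simp add: linear_conv_bounded_linear)
  have sgn_m[measurable]: "sgn \<in> borel_measurable (borel :: (real^'n) measure)"
    unfolding sgn_div_norm by measurable
  have sT: "sgn (T x) = T (sgn x)" for x
    by (simp add: sgn_div_norm nT linear_scale[OF lin])
  have T_S: "T \<in> measurable sphere_measure sphere_measure"
    unfolding sphere_measure_def
    by (intro measurable_restrict_space3) (auto simp: nT)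
  have em: "emeasure sphere_measure B = emeasure ?U (sgn -` B)"
    if "B \<in> sets borel" "B \<subseteq> sphere 0 1" for B :: "(real^'n) set"
    unfolding sphere_measure_def using that
    by (subst emeasure_restrict_space) (auto simp: emeasure_distr)
  fix A :: "(real^'n) set" assume "A \<in> sets (distr sphere_measure sphere_measure T)"
  then have A: "A \<in> sets sphere_measure" by simp
  then have A'[measurable]: "A \<in> sets borel" and As: "A \<subseteq> sphere 0 1"
    by (auto simp: sphere_measure_def sets_restrict_space_iff)
  have sp: "space sphere_measure = (sphere 0 1 :: (real^'n) set)"
    by (simp add: sphere_measure_def space_restrict_space)
  have vim: "T -` A \<inter> sphere 0 1 = T -` A" using As nT by fastforce
  have [measurable]: "T -` A \<in> sets borel" "sgn -` A \<in> sets borel"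
    using measurable_sets[OF T_m A'] measurable_sets[OF sgn_m A'] by auto
  have meas: "T -` (ball 0 1 \<inter> sgn -` A) \<in> sets borel"
    using measurable_sets[OF T_m, of "ball 0 1 \<inter> sgn -` A"] by auto
  have "emeasure (distr sphere_measure sphere_measure T) A = emeasure sphere_measure (T -` A)"
    by (simp add: emeasure_distr[OF T_S A] sp vim)
  also have "\<dots> = emeasure ?U (sgn -` (T -` A))"
    by (rule em) (use vim in auto)
  also have "sgn -` (T -` A) = T -` (sgn -` A)" by (auto simp: sT)
  also have "emeasure ?U (T -` (sgn -` A)) = emeasure ?U (sgn -` A)"
  proof -
    have "ball 0 1 \<inter> T -` (sgn -` A) = T -` (ball 0 1 \<inter> sgn -` A)" by (auto simp: nT)
    moreover have "T -` (sgn -` A) \<in> sets borel"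
      using measurable_sets[OF T_m, of "sgn -` A"] by auto
    moreover have "emeasure lborel (T -` (ball 0 1 \<inter> sgn -` A)) = emeasure lborel (ball 0 1 \<inter> sgn -` A)"
      by (subst (2) lborel_distr_orthogonal[OF T, symmetric]) (auto simp: emeasure_distr)
    ultimately show ?thesis by (simp add: emeasure_uniform_measure)
  qed
  also have "\<dots> = emeasure sphere_measure A" by (rule em[symmetric, OF A' As])
  finally show "emeasure (distr sphere_measure sphere_measure T) A = emeasure sphere_measure A" .
qed simp

end

theory Submission
  imports Defs
begin

text \<open>
  Every part of the theorem reduces to support functions. For fuzzy sets \<open>A\<close>, \<open>B\<close> and levels
  \<open>\<alpha> \<in> [0, 1]\<close> the support function is additive (\<open>support_fun_fuzzy_add\<close>), positively homogeneous
  (\<open>support_fun_fuzzy_scale\<close>), and turns a matrix into its transpose acting on the direction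
  (\<open>support_fun_fuzzy_matrix\<close>); all three follow from the fact that the fuzzy operations act on levels
  as the ordinary operations on sets. The outlyingness sees a fuzzy set only through the distance of
  its support function to a function of \<open>(u, \<alpha>)\<close> fixed by \<open>X\<close>, measured in the unit \<open>MAD\<close>, and the
  depth is a strictly decreasing function of the outlyingness (\<open>D_FP_le_iff\<close>).

  Affine invariance: under \<open>A \<mapsto> M A + V\<close> the random variable at \<open>(u, \<alpha>)\<close> becomes a positive affine
  image of the one at \<open>(\<phi> u, \<alpha>)\<close>, where \<open>\<phi>\<close> is the bijection \<open>u \<mapsto> M\<^sup>T u / |M\<^sup>T u|\<close> of the
  sphere. Median and \<open>MAD\<close> follow this affine map, so the ratios are merely permuted. Symmetry: the
  median of a symmetric variable is its centre, so the centre of symmetry has outlyingness zero.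

  Monotonicity away from a deepest set: if \<open>support_fun C\<close> is a convex combination of the support
  functions of \<open>A\<close> and \<open>B\<close>, then the outlyingness of \<open>C\<close> is at most the larger of the other two
  (\<open>outlyingness_between\<close>); when \<open>A\<close> is deepest this is the outlyingness of \<open>B\<close>. For
  \<open>(1 - \<gamma>) A + \<gamma> U\<close> the hypothesis is evident. For \<open>U\<close> between \<open>A\<close> and \<open>V\<close> in the metric
  \<open>\<rho>\<^sub>r\<close>, \<open>r > 1\<close>, it is the equality case of Minkowski's inequality (\<open>minkowski_equality\<close>), which
  comes from strict convexity of \<open>|x|\<^sup>r\<close>. That gives the identity almost everywhere only; it extends
  to all \<open>(u, \<alpha>)\<close> because support functions are continuous in \<open>u\<close>, left continuous in \<open>\<alpha>\<close> on
  \<open>(0, 1]\<close> and right continuous at \<open>0\<close>.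

  Vanishing at infinity: along a ray a single pair \<open>(u, \<alpha>)\<close> suffices. For divergent sequences the pair
  varies, so a uniform bound on medians and \<open>MAD\<close> is needed (\<open>support_med_MAD_uniformly_bounded\<close>); it
  exists because all \<open>|s\<^sub>X(u, \<alpha>)|\<close> are dominated by one finite random variable. All the metrics are
  dominated by the supremum distance of support functions (\<open>metrics_le_support_fun_diff\<close>), so
  divergence in any of them forces that supremum to diverge.
\<close>

section \<open>The extension principle\<close>

text \<open>
  Addition, scaling and matrix multiplication of fuzzy sets are all instances of this formula, so
  their levels can be computed once and for all.
\<close>

definition zadeh_extension :: "('a \<Rightarrow> 'b) \<Rightarrow> ('a \<Rightarrow> real) \<Rightarrow> 'b \<Rightarrow> real" where
  "zadeh_extension f C t = sup01 {C z | z. f z = t}"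

lemma fuzzy_add_eq_zadeh:
  "fuzzy_add A B = zadeh_extension (\<lambda>(x, y). x + y) (\<lambda>(x, y). min (A x) (B y))"
  by (auto simp: fun_eq_iff fuzzy_add_def zadeh_extension_def intro!: arg_cong[where f=sup01])

lemma fuzzy_scale_eq_zadeh: "fuzzy_scale \<gamma> A = zadeh_extension ((*\<^sub>R) \<gamma>) A"
  by (simp add: fun_eq_iff fuzzy_scale_def zadeh_extension_def)

lemma fuzzy_matrix_eq_zadeh: "fuzzy_matrix M A = zadeh_extension ((*v) M) A"
  by (simp add: fun_eq_iff fuzzy_matrix_def zadeh_extension_def)

context
  fixes C :: "'a::heine_borel \<Rightarrow> real" and f :: "'a \<Rightarrow> 'b::t2_space"
  assumes range: "\<And>z. C z \<in> {0..1}"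
    and compact_superlevel: "\<And>\<beta>. 0 < \<beta> \<Longrightarrow> \<beta> \<le> 1 \<Longrightarrow> compact {z. C z \<ge> \<beta>}"
    and cont: "continuous_on UNIV f"
begin

lemma bdd_above_zadeh: "bdd_above (insert 0 {C z | z. f z = t})"
  using range by (intro bdd_aboveI[of _ 1]) fastforce

lemma zadeh_ge: "C z \<le> zadeh_extension f C (f z)"
  unfolding zadeh_extension_def sup01_def by (rule cSup_upper[OF _ bdd_above_zadeh]) auto

lemma zadeh_range: "zadeh_extension f C t \<in> {0..1}"
proof -
  have "0 \<le> zadeh_extension f C t"
    unfolding zadeh_extension_def sup01_def by (rule cSup_upper[OF _ bdd_above_zadeh]) auto
  moreover have "zadeh_extension f C t \<le> 1"
    unfolding zadeh_extension_def sup01_def by (rule cSup_least) (use range in fastforce)+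
  ultimately show ?thesis by simp
qed

text \<open>
  A positive supremum is attained: the points of the fibre at which \<open>C\<close> is almost maximal form a
  decreasing sequence of non-empty compact sets, and any common point is a maximizer. Attainment is
  what makes the superlevel sets of the extension exact images.
\<close>

lemma zadeh_attained:
  assumes pos: "0 < zadeh_extension f C t"
  shows "\<exists>z. f z = t \<and> C z = zadeh_extension f C t"
proof -
  define s where "s = zadeh_extension f C t"
  have s: "0 < s" "s \<le> 1" using pos zadeh_range[of t] by (auto simp: s_def)
  \<comment> \<open>The thresholds increase to \<open>s\<close> and stay positive, where superlevel sets are compact.\<close>
  define F where "F n = {z. C z \<ge> s - s / (real n + 2)} \<inter> f -` {t}" for n
  have lt: "s / (real n + 2) < s" "0 < s / (real n + 2)" for n
    using s by (auto simp: divide_less_eq mult_less_cancel_left1 add_nonneg_pos)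
  have cl: "closed (f -` {t})" using continuous_closed_vimage[of "{t}" f] cont
    by (auto simp: continuous_on_eq_continuous_at)
  have "compact (F n)" for n
  proof -
    have "0 < s - s / (real n + 2)" "s - s / (real n + 2) \<le> 1" using lt[of n] s by linarith+
    then show ?thesis unfolding F_def by (intro compact_Int_closed compact_superlevel cl)
  qed
  moreover have "F n \<noteq> {}" for n
  proof -
    have "s - s / (real n + 2) < Sup (insert 0 {C z | z. f z = t})"
      using lt(2)[of n] by (simp add: s_def zadeh_extension_def sup01_def)
    then obtain v where v: "v \<in> insert 0 {C z | z. f z = t}" "s - s / (real n + 2) < v"
      using less_cSup_iff[OF _ bdd_above_zadeh] by blast
    with lt(1)[of n] have "v \<noteq> 0" by auto
    with v show ?thesis by (force simp: F_def)
  qed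
  moreover have "F n \<subseteq> F m" if "m \<le> n" for m n
  proof -
    have "s / (real n + 2) \<le> s / (real m + 2)" using that s by (intro divide_left_mono) auto
    then show ?thesis by (auto simp: F_def)
  qed
  ultimately have "\<Inter> (range F) \<noteq> {}" by (rule compact_nest)
  then obtain z where z: "\<And>n. z \<in> F n" by auto
  have "C z \<ge> s"
  proof (rule field_le_epsilon)
    fix e :: real assume "0 < e"
    then obtain n where "s / e < real n" using reals_Archimedean2 by blast
    then have "s / (real n + 2) \<le> e" using \<open>0 < e\<close> s by (simp add: field_simps)
    moreover have "C z \<ge> s - s / (real n + 2)" using z[of n] by (simp add: F_def)
    ultimately show "s \<le> C z + e" by linarith
  qed
  moreover have "f z = t" using z[of 0] by (simp add: F_def)
  moreover have "C z \<le> s" using zadeh_ge[of z] \<open>f z = t\<close> by (simp add: s_def)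
  ultimately show ?thesis by (intro exI[of _ z]) (auto simp: s_def)
qed

lemma zadeh_superlevel:
  assumes "0 < \<alpha>"
  shows "{t. zadeh_extension f C t \<ge> \<alpha>} = f ` {z. C z \<ge> \<alpha>}"
proof -
  have "t \<in> f ` {z. C z \<ge> \<alpha>}" if "zadeh_extension f C t \<ge> \<alpha>" for t
    using zadeh_attained[of t] that assms by force
  then show ?thesis using zadeh_ge order_trans by blast
qed

lemma zadeh_support: "{t. zadeh_extension f C t > 0} = f ` {z. C z > 0}"
proof -
  have "t \<in> f ` {z. C z > 0}" if "zadeh_extension f C t > 0" for t
    using zadeh_attained[of t] that by force
  then show ?thesis using zadeh_ge less_le_trans by blast
qed

text \<open>
  The level at \<open>0\<close> is a closure, and a continuous image commutes with closure when that closure is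
  compact.
\<close>

lemma zadeh_closure_support:
  assumes "compact (closure {z. C z > 0})"
  shows "closure {t. zadeh_extension f C t > 0} = f ` closure {z. C z > 0}"
proof -
  have c: "continuous_on (closure {z. C z > 0}) f" using cont continuous_on_subset by blast
  show ?thesis unfolding zadeh_support
  proof (intro subset_antisym closure_minimal)
    show "closed (f ` closure {z. C z > 0})"
      by (intro compact_imp_closed compact_continuous_image[OF c] assms)
    show "f ` closure {z. C z > 0} \<subseteq> closure (f ` {z. C z > 0})"
      by (intro image_closure_subset[OF c]) (auto simp: closure_subset)
  qed (auto intro: closure_subset[THEN subsetD])
qed

end

section \<open>Levels\<close>

lemma fuzzy_set_range: "A \<in> fuzzy_sets \<Longrightarrow> A x \<in> {0..1}"
  by (auto simp: fuzzy_sets_def)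

lemma fuzzy_set_level:
  assumes "A \<in> fuzzy_sets" "\<alpha> \<in> {0..1}"
  shows "level A \<alpha> \<noteq> {}" "compact (level A \<alpha>)" "convex (level A \<alpha>)" "level A \<alpha> \<in> convex_bodies"
  using assms by (auto simp: fuzzy_sets_def convex_bodies_def)

lemma level_antimono:
  assumes "0 \<le> \<alpha>" "\<alpha> \<le> \<beta>" 
  shows "level A \<beta> \<subseteq> level A \<alpha>"
proof (cases "\<alpha> = 0 \<and> \<beta> > 0")
  case True
  have "{x. A x \<ge> \<beta>} \<subseteq> {x. A x > 0}" using True by auto
  then show ?thesis using True closure_subset[of "{x. A x > 0}"] by (auto simp: level_def)
qed (use assms in \<open>auto simp: level_def\<close>)

lemma level_zadeh_linear:
  fixes f :: "real^'n \<Rightarrow> real^'n"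
  assumes A: "A \<in> fuzzy_sets" and f: "linear f" and \<alpha>: "\<alpha> \<in> {0..1}"
  shows "level (zadeh_extension f A) \<alpha> = f ` level A \<alpha>"
proof -
  have 1: "compact {z. A z \<ge> \<beta>}" if "0 < \<beta>" "\<beta> \<le> 1" for \<beta>
    using fuzzy_set_level(2)[OF A, of \<beta>] that by (simp add: level_def)
  have 2: "continuous_on UNIV f" using f by (simp add: linear_continuous_on linear_conv_bounded_linear)
  have 3: "compact (closure {z. A z > 0})" using fuzzy_set_level(2)[OF A, of 0] by (simp add: level_def)
  show ?thesis
    using zadeh_closure_support[OF fuzzy_set_range[OF A] 1 2 3]
      zadeh_superlevel[OF fuzzy_set_range[OF A] 1 2, of \<alpha>] \<alpha> by (auto simp: level_def)
qed

text \<open>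
  Here \<open>C (x, y) = min (A x) (B y)\<close>, whose superlevel sets are products of the superlevel sets of
  \<open>A\<close> and \<open>B\<close>.
\<close>

lemma level_fuzzy_add:
  assumes A: "A \<in> fuzzy_sets" and B: "B \<in> fuzzy_sets" and \<alpha>: "\<alpha> \<in> {0..1}"
  shows "level (fuzzy_add A B) \<alpha> = (\<lambda>(x, y). x + y) ` (level A \<alpha> \<times> level B \<alpha>)"
proof -
  let ?C = "\<lambda>(x, y). min (A x) (B y)"
  have sup: "{z. ?C z \<ge> \<beta>} = {x. A x \<ge> \<beta>} \<times> {y. B y \<ge> \<beta>}" for \<beta> by auto
  have sup0: "closure {z. ?C z > 0} = closure {x. A x > 0} \<times> closure {y. B y > 0}"
    unfolding closure_Times[symmetric] by (rule arg_cong[where f=closure]) auto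
  have r: "?C z \<in> {0..1}" for z
    using fuzzy_set_range[OF A, of "fst z"] fuzzy_set_range[OF B, of "snd z"]
    by (auto simp: min_def split: prod.splits)
  have 1: "compact {z. ?C z \<ge> \<beta>}" if "0 < \<beta>" "\<beta> \<le> 1" for \<beta>
    unfolding sup using fuzzy_set_level(2)[OF A, of \<beta>] fuzzy_set_level(2)[OF B, of \<beta>] that
    by (intro compact_Times) (auto simp: level_def)
  have 2: "continuous_on UNIV (\<lambda>(x, y). x + y :: real^'n)"
    by (simp add: case_prod_unfold continuous_intros)
  have 3: "compact (closure {z. ?C z > 0})"
    unfolding sup0 using fuzzy_set_level(2)[OF A, of 0] fuzzy_set_level(2)[OF B, of 0]
    by (intro compact_Times) (auto simp: level_def)
  show ?thesis
    using zadeh_closure_support[OF r 1 2 3] zadeh_superlevel[OF r 1 2, of \<alpha>] \<alpha>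
    unfolding sup sup0 fuzzy_add_eq_zadeh by (auto simp: level_def)
qed

lemma zadeh_linear_fuzzy_set:
  fixes f :: "real^'n \<Rightarrow> real^'n"
  assumes A: "A \<in> fuzzy_sets" and f: "linear f"
  shows "zadeh_extension f A \<in> fuzzy_sets"
proof -
  have "compact {z. A z \<ge> \<beta>}" if "0 < \<beta>" "\<beta> \<le> 1" for \<beta>
    using fuzzy_set_level(2)[OF A, of \<beta>] that by (simp add: level_def)
  moreover have c: "continuous_on S f" for S
    using f by (simp add: linear_continuous_on linear_conv_bounded_linear)
  ultimately have "zadeh_extension f A t \<in> {0..1}" for t
    by (intro zadeh_range fuzzy_set_range[OF A])
  then show ?thesis
    using fuzzy_set_level[OF A] c
    by (auto simp: fuzzy_sets_def level_zadeh_linear[OF A f] convex_bodies_def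
        intro!: compact_continuous_image convex_linear_image[OF f])
qed

lemma fuzzy_add_fuzzy_set:
  assumes A: "A \<in> fuzzy_sets" and B: "B \<in> fuzzy_sets"
  shows "fuzzy_add A B \<in> fuzzy_sets"
proof -
  have lin: "linear (\<lambda>(x, y). x + y :: real^'n)"
    by (auto intro!: linearI simp: algebra_simps)
  have "fuzzy_add A B t \<in> {0..1}" for t
  proof -
    have "bdd_above (insert 0 {min (A x) (B y) |x y. x + y = t})"
      using fuzzy_set_range[OF A] by (intro bdd_aboveI[of _ 1]) (auto simp: min_le_iff_disj)
    then have "0 \<le> fuzzy_add A B t"
      unfolding fuzzy_add_def sup01_def by (intro cSup_upper) auto
    moreover have "fuzzy_add A B t \<le> 1"
      unfolding fuzzy_add_def sup01_def
      using fuzzy_set_range[OF A] by (intro cSup_least) (auto simp: min_le_iff_disj)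
    ultimately show ?thesis by simp
  qed
  then show ?thesis
    using fuzzy_set_level[OF A] fuzzy_set_level[OF B] lin
    by (auto simp: fuzzy_sets_def level_fuzzy_add[OF A B] convex_bodies_def linear_continuous_on
        linear_conv_bounded_linear
        intro!: compact_continuous_image compact_Times convex_linear_image convex_Times)
qed

section \<open>Support functions\<close>

text \<open>
  Stated for plain sets, since measurability of a fuzzy random variable is given level by level.
\<close>

definition set_support :: "(real^'n) set \<Rightarrow> real^'n \<Rightarrow> real" where
  "set_support K u = (SUP v\<in>K. u \<bullet> v)"

lemma support_fun_eq: "support_fun A u \<alpha> = set_support (level A \<alpha>) u"
  by (simp add: support_fun_def set_support_def)

lemma set_support_upper:
  assumes "compact K" "v \<in> K" shows "u \<bullet> v \<le> set_support K u"
proof -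
  have "bounded ((\<bullet>) u ` K)"
    using assms by (intro compact_imp_bounded compact_continuous_image continuous_intros)
  then show ?thesis
    unfolding set_support_def by (intro cSUP_upper assms bounded_imp_bdd_above)
qed

lemma set_support_attained:
  assumes "compact K" "K \<noteq> {}" shows "\<exists>v\<in>K. set_support K u = u \<bullet> v"
proof -
  have "continuous_on K ((\<bullet>) u)" by (intro continuous_intros)
  from continuous_attains_sup[OF assms this] obtain v where
    v: "v \<in> K" "\<And>w. w \<in> K \<Longrightarrow> u \<bullet> w \<le> u \<bullet> v" by blast
  then have "set_support K u \<le> u \<bullet> v" unfolding set_support_def by (intro cSUP_least) auto
  then show ?thesis using set_support_upper[OF assms(1) v(1), of u] v(1) by (auto intro: antisym)
qed

text \<open>
  A maximizer for \<open>K\<close> has a point of \<open>L\<close> within the Hausdorff distance, and a unit functional changes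
  by at most that distance.
\<close>

lemma set_support_diff_le_hausdorff:
  assumes K: "K \<in> convex_bodies" and L: "L \<in> convex_bodies" and u: "norm u = 1"
  shows "\<bar>set_support K u - set_support L u\<bar> \<le> hausdorff_dist K L"
proof -
  have *: "set_support K u \<le> set_support L u + hausdorff_dist K L"
    if K: "K \<in> convex_bodies" and L: "L \<in> convex_bodies" for K L
  proof -
    have c: "compact K" "K \<noteq> {}" "compact L" "L \<noteq> {}" using K L by (auto simp: convex_bodies_def)
    obtain v where v: "v \<in> K" "set_support K u = u \<bullet> v" using set_support_attained c by blast
    obtain w where w: "w \<in> L" "infdist v L = dist v w"
      using infdist_attains_inf[of L v] c by (auto simp: compact_imp_closed)
    have "bounded ((\<lambda>x. infdist x L) ` K)"
      using c by (intro compact_imp_bounded compact_continuous_image continuous_intros)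
    then have "infdist v L \<le> (SUP x\<in>K. infdist x L)"
      using v by (intro cSUP_upper bounded_imp_bdd_above)
    also have "\<dots> \<le> hausdorff_dist K L" by (simp add: hausdorff_dist_convex_bodies[OF K L])
    finally have "norm (v - w) \<le> hausdorff_dist K L" using w by (simp add: dist_norm)
    moreover have "u \<bullet> (v - w) \<le> norm u * norm (v - w)" by (rule norm_cauchy_schwarz)
    moreover have "u \<bullet> w \<le> set_support L u" using c w by (intro set_support_upper)
    ultimately show ?thesis using v u by (simp add: inner_diff_right)
  qed
  have "hausdorff_dist L K = hausdorff_dist K L"
    by (auto simp: hausdorff_dist_def max.commute)
  with *[OF K L] *[OF L K] show ?thesis by simp
qed

text \<open>
  The unit vector from a nearest point of \<open>L\<close> to a point of \<open>K\<close> outside \<open>L\<close> separates that point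
  from \<open>L\<close>, and in this direction the support functions differ by at least the distance to \<open>L\<close>.
\<close>

lemma hausdorff_le_set_support_diff:
  assumes K: "K \<in> convex_bodies" and L: "L \<in> convex_bodies" and C: "0 \<le> C"
    and le: "\<And>u. norm u = 1 \<Longrightarrow> \<bar>set_support K u - set_support L u\<bar> \<le> C"
  shows "hausdorff_dist K L \<le> C"
proof -
  have *: "infdist x L \<le> C" if K: "K \<in> convex_bodies" and L: "L \<in> convex_bodies"
    and le: "\<And>u. norm u = 1 \<Longrightarrow> set_support K u - set_support L u \<le> C" and x: "x \<in> K" for x K L
  proof -
    have c: "compact K" "K \<noteq> {}" "compact L" "L \<noteq> {}" "convex L" "closed L"
      using K L by (auto simp: convex_bodies_def compact_imp_closed)
    obtain y where y: "y \<in> L" "infdist x L = dist x y"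
      using infdist_attains_inf[of L x] c by (auto simp: compact_imp_closed)
    show ?thesis
    proof (cases "x = y")
      case False
      define u where "u = (x - y) /\<^sub>R norm (x - y)"
      have u: "norm u = 1" using False by (simp add: u_def)
      have "(x - y) \<bullet> (z - y) \<le> 0" if "z \<in> L" for z
        using any_closest_point_dot[OF c(5,6) y(1) that, of x] y(2) infdist_le[of _ L x] by metis
      then have "u \<bullet> (z - y) \<le> 0" if "z \<in> L" for z
        using that by (auto simp: u_def mult_nonneg_nonpos)
      then have "set_support L u \<le> u \<bullet> y"
        using set_support_attained[OF c(3,4), of u] by (auto simp: inner_diff_right)
      moreover have "u \<bullet> x \<le> set_support K u" using c x by (intro set_support_upper)
      moreover have "u \<bullet> (x - y) = norm (x - y)"
        using False by (simp add: u_def dot_square_norm power2_eq_square)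
      ultimately show ?thesis using le[OF u] y(2) by (simp add: inner_diff_right dist_norm)
    qed (use y C in simp)
  qed
  have "(SUP x\<in>K. infdist x L) \<le> C"
    using K by (intro cSUP_least *[OF K L]) (auto simp: convex_bodies_def dest!: le)
  moreover have "(SUP x\<in>L. infdist x K) \<le> C"
    using L by (intro cSUP_least *[OF L K]) (auto simp: convex_bodies_def dest!: le)
  ultimately show ?thesis by (simp add: hausdorff_dist_convex_bodies[OF K L])
qed

context
  fixes A :: "(real^'n) \<Rightarrow> real" and \<alpha> :: real
  assumes A: "A \<in> fuzzy_sets" and \<alpha>: "\<alpha> \<in> {0..1}"
begin

lemma support_fun_upper: "v \<in> level A \<alpha> \<Longrightarrow> u \<bullet> v \<le> support_fun A u \<alpha>"
  unfolding support_fun_eq by (rule set_support_upper[OF fuzzy_set_level(2)[OF A \<alpha>]])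

lemma support_fun_attained: "\<exists>v\<in>level A \<alpha>. support_fun A u \<alpha> = u \<bullet> v"
  unfolding support_fun_eq by (rule set_support_attained[OF fuzzy_set_level(2,1)[OF A \<alpha>]])

lemma support_fun_scaleR:
  assumes "0 \<le> c" shows "support_fun A (c *\<^sub>R u) \<alpha> = c * support_fun A u \<alpha>"
proof -
  obtain v w where vw: "v \<in> level A \<alpha>" "support_fun A u \<alpha> = u \<bullet> v"
      "w \<in> level A \<alpha>" "support_fun A (c *\<^sub>R u) \<alpha> = c *\<^sub>R u \<bullet> w"
    using support_fun_attained by meson
  have "c * (u \<bullet> w) \<le> c * (u \<bullet> v)"
    using support_fun_upper[OF vw(3), of u] vw(2) assms by (intro mult_left_mono) auto
  then show ?thesis using support_fun_upper[OF vw(1), of "c *\<^sub>R u"] vw by auto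
qed

lemma support_fun_fuzzy_scale:
  assumes "0 \<le> c" shows "support_fun (fuzzy_scale c A) u \<alpha> = c * support_fun A u \<alpha>"
proof -
  have "support_fun (fuzzy_scale c A) u \<alpha> = support_fun A (c *\<^sub>R u) \<alpha>"
    using level_zadeh_linear[OF A linear_scale_self \<alpha>, of c]
    by (simp add: support_fun_def fuzzy_scale_eq_zadeh image_image)
  then show ?thesis using support_fun_scaleR[OF assms] by simp
qed

lemma support_fun_fuzzy_matrix:
  "support_fun (fuzzy_matrix M A) u \<alpha> = support_fun A (transpose M *v u) \<alpha>"
  using level_zadeh_linear[OF A matrix_vector_mul_linear \<alpha>, of M]
  by (simp add: support_fun_def fuzzy_matrix_eq_zadeh image_image dot_lmul_matrix[symmetric]
      transpose_matrix_vector)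

lemma support_fun_antimono:
  assumes "\<alpha> \<le> \<beta>" "\<beta> \<le> 1" shows "support_fun A u \<beta> \<le> support_fun A u \<alpha>"
proof -
  have "\<beta> \<in> {0..1}" using assms \<alpha> by auto
  from set_support_attained[OF fuzzy_set_level(2,1)[OF A this], of u]
  obtain v where "v \<in> level A \<beta>" "support_fun A u \<beta> = u \<bullet> v" by (auto simp: support_fun_eq)
  then show ?thesis using support_fun_upper[of v] level_antimono[of \<alpha> \<beta> A] assms \<alpha> by auto
qed

end

lemma support_fun_fuzzy_add:
  assumes A: "A \<in> fuzzy_sets" and B: "B \<in> fuzzy_sets" and \<alpha>: "\<alpha> \<in> {0..1}"
  shows "support_fun (fuzzy_add A B) u \<alpha> = support_fun A u \<alpha> + support_fun B u \<alpha>"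
proof -
  note AB = fuzzy_add_fuzzy_set[OF A B]
  obtain v w where vw: "v \<in> level A \<alpha>" "support_fun A u \<alpha> = u \<bullet> v"
      "w \<in> level B \<alpha>" "support_fun B u \<alpha> = u \<bullet> w"
    using support_fun_attained[OF A \<alpha>] support_fun_attained[OF B \<alpha>] by meson
  have "v + w \<in> level (fuzzy_add A B) \<alpha>"
    using vw by (force simp: level_fuzzy_add[OF A B \<alpha>])
  from support_fun_upper[OF AB \<alpha> this, of u]
  have "support_fun A u \<alpha> + support_fun B u \<alpha> \<le> support_fun (fuzzy_add A B) u \<alpha>"
    using vw by (simp add: inner_add_right)
  moreover obtain x y where "x \<in> level A \<alpha>" "y \<in> level B \<alpha>"
      "support_fun (fuzzy_add A B) u \<alpha> = u \<bullet> (x + y)"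
    using support_fun_attained[OF AB \<alpha>, of u] by (auto simp: level_fuzzy_add[OF A B \<alpha>])
  then have "support_fun (fuzzy_add A B) u \<alpha> \<le> support_fun A u \<alpha> + support_fun B u \<alpha>"
    using support_fun_upper[OF A \<alpha>] support_fun_upper[OF B \<alpha>]
    by (simp add: inner_add_right add_mono)
  ultimately show ?thesis by simp
qed


lemma fuzzy_set_bounded:
  assumes A: "A \<in> fuzzy_sets"
  obtains R where "0 < R" "\<And>\<alpha> v. \<alpha> \<in> {0..1} \<Longrightarrow> v \<in> level A \<alpha> \<Longrightarrow> norm v \<le> R"
proof -
  have "bounded (level A 0)" using fuzzy_set_level(2)[OF A, of 0] compact_imp_bounded by auto
  then obtain R where "0 < R" "\<And>v. v \<in> level A 0 \<Longrightarrow> norm v \<le> R" using bounded_pos by blast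
  moreover have "level A \<alpha> \<subseteq> level A 0" if "\<alpha> \<in> {0..1}" for \<alpha>
    using level_antimono[of 0 \<alpha> A] that by simp
  ultimately show ?thesis using that[of R] by blast
qed

lemma support_fun_lipschitz:
  assumes A: "A \<in> fuzzy_sets" and \<alpha>: "\<alpha> \<in> {0..1}"
    and R: "\<And>v. v \<in> level A \<alpha> \<Longrightarrow> norm v \<le> R"
  shows "\<bar>support_fun A u \<alpha> - support_fun A w \<alpha>\<bar> \<le> R * norm (u - w)"
proof -
  have *: "support_fun A u \<alpha> - support_fun A w \<alpha> \<le> R * norm (u - w)" for u w
  proof -
    obtain v where v: "v \<in> level A \<alpha>" "support_fun A u \<alpha> = u \<bullet> v"
      using support_fun_attained[OF A \<alpha>] by blast
    have "(u - w) \<bullet> v \<le> norm (u - w) * norm v" by (rule norm_cauchy_schwarz)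
    also have "\<dots> \<le> norm (u - w) * R" using R[OF v(1)] by (intro mult_left_mono) auto
    finally show ?thesis
      using support_fun_upper[OF A \<alpha> v(1), of w] v by (simp add: inner_diff_left mult.commute)
  qed
  from *[of u w] *[of w u] show ?thesis by (simp add: norm_minus_commute)
qed

lemma support_fun_zero: "A \<in> fuzzy_sets \<Longrightarrow> \<alpha> \<in> {0..1} \<Longrightarrow> support_fun A 0 \<alpha> = 0"
  using support_fun_scaleR[of A \<alpha> 0 0] by simp

lemma support_fun_bound:
  assumes A: "A \<in> fuzzy_sets" and \<alpha>: "\<alpha> \<in> {0..1}"
    and R: "\<And>v. v \<in> level A \<alpha> \<Longrightarrow> norm v \<le> R"
  shows "\<bar>support_fun A u \<alpha>\<bar> \<le> R * norm u"
  using support_fun_lipschitz[OF assms, of u 0] support_fun_zero[OF A \<alpha>] by simp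

lemma support_fun_continuous:
  assumes A: "A \<in> fuzzy_sets" and \<alpha>: "\<alpha> \<in> {0..1}"
  shows "continuous_on S (\<lambda>u. support_fun A u \<alpha>)"
proof -
  obtain R where R: "0 < R" "\<And>\<alpha> v. \<alpha> \<in> {0..1} \<Longrightarrow> v \<in> level A \<alpha> \<Longrightarrow> norm v \<le> R"
    using fuzzy_set_bounded[OF A] by blast
  have "R-lipschitz_on S (\<lambda>u. support_fun A u \<alpha>)"
    using support_fun_lipschitz[OF A \<alpha>, of R] R \<alpha>
    by (intro lipschitz_onI) (auto simp: dist_norm)
  then show ?thesis by (rule lipschitz_on_continuous_on)
qed

text \<open>
  The right-hand side depends neither on \<open>u\<close> nor on \<open>\<alpha>\<close> and is a finite sum of support functions, so
  for a fuzzy random variable it is a measurable uniform bound.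
\<close>

lemma support_fun_coordinate_bound:
  fixes u :: "real^'n"
  assumes A: "A \<in> fuzzy_sets" and \<alpha>: "\<alpha> \<in> {0..1}" and u: "norm u = 1"
  shows "\<bar>support_fun A u \<alpha>\<bar> \<le> (\<Sum>b\<in>Basis. \<bar>support_fun A b 0\<bar> + \<bar>support_fun A (- b) 0\<bar>)"
proof -
  obtain v where v: "v \<in> level A \<alpha>" "support_fun A u \<alpha> = u \<bullet> v"
    using support_fun_attained[OF A \<alpha>] by blast
  then have v0: "v \<in> level A 0" using level_antimono[of 0 \<alpha> A] \<alpha> by auto
  have "\<bar>u \<bullet> v\<bar> \<le> norm v" using Cauchy_Schwarz_ineq2[of u v] u by simp
  also have "\<dots> \<le> (\<Sum>b\<in>Basis. \<bar>v \<bullet> b\<bar>)" by (rule norm_le_l1)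
  also have "\<dots> \<le> (\<Sum>b\<in>Basis. \<bar>support_fun A b 0\<bar> + \<bar>support_fun A (- b) 0\<bar>)"
  proof (rule sum_mono)
    fix b :: "real^'n"
    show "\<bar>v \<bullet> b\<bar> \<le> \<bar>support_fun A b 0\<bar> + \<bar>support_fun A (- b) 0\<bar>"
      using support_fun_upper[OF A _ v0, of b] support_fun_upper[OF A _ v0, of "- b"]
      by (simp add: inner_commute)
  qed
  finally show ?thesis using v by simp
qed

text \<open>
  Otherwise the closed half space \<open>{x. u \<bullet> x \<ge> s + e}\<close> would meet every level below \<open>\<alpha>\<close>; by
  compactness it would then meet their intersection, which is the level at \<open>\<alpha>\<close>.
\<close>

lemma support_fun_left_continuous:
  assumes A: "A \<in> fuzzy_sets" and \<alpha>: "0 < \<alpha>" "\<alpha> \<le> 1"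
  shows "(support_fun A u \<longlongrightarrow> support_fun A u \<alpha>) (at_left \<alpha>)"
proof (rule tendstoI)
  fix e :: real assume e: "0 < e"
  define s where "s = support_fun A u \<alpha>"
  define \<beta> where "\<beta> n = \<alpha> - \<alpha> / (real n + 2)" for n
  have \<beta>: "0 < \<beta> n" "\<beta> n < \<alpha>" for n
    using \<alpha> by (auto simp: \<beta>_def divide_less_eq mult_less_cancel_left1 add_nonneg_pos)
  define F where "F n = level A (\<beta> n) \<inter> {x. u \<bullet> x \<ge> s + e}" for n
  have "\<exists>n. support_fun A u (\<beta> n) < s + e"
  proof (rule ccontr)
    assume "\<nexists>n. support_fun A u (\<beta> n) < s + e"
    then have ge: "support_fun A u (\<beta> n) \<ge> s + e" for n by (auto simp: not_less)
    have bn: "\<beta> n \<in> {0..1}" for n using \<beta>[of n] \<alpha> by auto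
    have "compact (F n)" for n
      unfolding F_def by (intro compact_Int_closed fuzzy_set_level(2)[OF A bn] closed_halfspace_ge)
    moreover have "F n \<noteq> {}" for n
      using support_fun_attained[OF A bn, of n u] ge[of n] by (auto simp: F_def)
    moreover have "F n \<subseteq> F m" if "m \<le> n" for m n
    proof -
      have "\<alpha> / (real n + 2) \<le> \<alpha> / (real m + 2)" using that \<alpha> by (intro divide_left_mono) auto
      then show ?thesis
        using level_antimono[of "\<beta> m" "\<beta> n" A] \<beta>[of m] by (auto simp: F_def \<beta>_def)
    qed
    ultimately have "\<Inter> (range F) \<noteq> {}" by (rule compact_nest)
    then obtain x where x: "\<And>n. x \<in> F n" by auto
    have "A x \<ge> \<alpha>"
    proof (rule field_le_epsilon)
      fix e' :: real assume "0 < e'"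
      then obtain n where "\<alpha> / e' < real n" using reals_Archimedean2 by blast
      then have "\<alpha> / (real n + 2) \<le> e'" using \<open>0 < e'\<close> \<alpha> by (simp add: field_simps)
      moreover have "A x \<ge> \<beta> n" using x[of n] \<beta>(1)[of n] by (simp add: F_def level_def)
      ultimately show "\<alpha> \<le> A x + e'" by (simp add: \<beta>_def)
    qed
    then have "u \<bullet> x \<le> s" using support_fun_upper[OF A, of \<alpha> x u] \<alpha> by (simp add: s_def level_def)
    with x[of 0] e show False by (simp add: F_def)
  qed
  then obtain n where n: "support_fun A u (\<beta> n) < s + e" by blast
  have "dist (support_fun A u \<gamma>) s < e" if \<gamma>: "\<gamma> \<in> {\<beta> n<..<\<alpha>}" for \<gamma>
  proof -
    have "support_fun A u \<gamma> \<le> support_fun A u (\<beta> n)"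
      using \<gamma> \<alpha> \<beta>[of n] by (intro support_fun_antimono[OF A]) auto
    moreover have "s \<le> support_fun A u \<gamma>"
      unfolding s_def using \<gamma> \<alpha> less_trans[OF \<beta>(1)[of n], of \<gamma>] by (intro support_fun_antimono[OF A]) auto
    ultimately show ?thesis using n by (simp add: dist_real_def)
  qed
  then show "\<forall>\<^sub>F x in at_left \<alpha>. dist (support_fun A u x) (support_fun A u \<alpha>) < e"
    unfolding s_def[symmetric] by (rule eventually_at_leftI[OF _ \<beta>(2)])
qed

text \<open>
  A maximizer in the closure of the support is approximated by points of positive membership, and
  such a point lies in all sufficiently low levels.
\<close>

lemma support_fun_right_continuous_at_0:
  assumes A: "A \<in> fuzzy_sets"
  shows "(support_fun A u \<longlongrightarrow> support_fun A u 0) (at_right 0)"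
proof (rule tendstoI)
  fix e :: real assume e: "0 < e"
  obtain v where v: "v \<in> level A 0" "support_fun A u 0 = u \<bullet> v"
    using support_fun_attained[OF A, of 0 u] by auto
  have "continuous (at v) ((\<bullet>) u)" by (intro continuous_intros)
  then obtain d where d: "0 < d" "\<And>w. dist w v < d \<Longrightarrow> dist (u \<bullet> w) (u \<bullet> v) < e"
    using e unfolding continuous_at_eps_delta by blast
  obtain w where w: "A w > 0" "dist w v < d"
    using v(1) d(1) by (auto simp: level_def closure_approachable)
  have "dist (support_fun A u \<gamma>) (support_fun A u 0) < e" if "\<gamma> \<in> {0<..<A w}" for \<gamma>
  proof -
    have g: "\<gamma> \<in> {0..1}" using that fuzzy_set_range[OF A, of w] by auto
    then have "w \<in> level A \<gamma>" using that by (auto simp: level_def)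
    from support_fun_upper[OF A g this, of u] support_fun_antimono[OF A, of 0 \<gamma> u] g d(2)[OF w(2)] v
    show ?thesis by (auto simp: dist_real_def)
  qed
  then show "\<forall>\<^sub>F x in at_right 0. dist (support_fun A u x) (support_fun A u 0) < e"
    by (rule eventually_at_rightI[OF _ w(1)])
qed

lemma fuzzy_set_eq_indicator_zero:
  assumes A: "A \<in> fuzzy_sets" and z: "\<And>u \<alpha>. norm u = 1 \<Longrightarrow> \<alpha> \<in> {0..1} \<Longrightarrow> support_fun A u \<alpha> = 0"
  shows "A = indicator {0}"
proof -
  have le0: "x = 0" if "x \<in> level A \<alpha>" "\<alpha> \<in> {0..1}" for x \<alpha>
  proof (rule ccontr)
    assume "x \<noteq> 0"
    then have n: "norm (x /\<^sub>R norm x) = 1" by simp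
    have "(x /\<^sub>R norm x) \<bullet> x \<le> 0" using support_fun_upper[OF A that(2,1), of "x /\<^sub>R norm x"] z[OF n that(2)] by simp
    moreover have "(x /\<^sub>R norm x) \<bullet> x = norm x"
      using \<open>x \<noteq> 0\<close> by (simp add: dot_square_norm power2_eq_square)
    ultimately show False using \<open>x \<noteq> 0\<close> by simp
  qed
  have "A x = 0" if "x \<noteq> 0" for x
  proof (rule ccontr)
    assume "A x \<noteq> 0"
    then have "A x > 0" using fuzzy_set_range[OF A, of x] by auto
    then show False using le0[of x "A x"] that fuzzy_set_range[OF A, of x] by (auto simp: level_def)
  qed
  moreover have "A 0 = 1"
  proof -
    obtain x where x: "x \<in> level A 1" using fuzzy_set_level(1)[OF A, of 1] by auto
    then have "A x \<ge> 1" "x = 0" using le0[of x 1] by (auto simp: level_def)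
    then show ?thesis using fuzzy_set_range[OF A, of x] by auto
  qed
  ultimately show ?thesis by (auto simp: fun_eq_iff indicator_def)
qed

section \<open>Measurability\<close>

text \<open>
  The map is 1-Lipschitz for the Hausdorff metric, so preimages of open sets are open.
\<close>

lemma set_support_measurable:
  assumes u: "norm u = 1"
  shows "(\<lambda>K. set_support K u) \<in> borel_measurable convex_bodies_borel"
proof (rule borel_measurableI)
  fix S :: "real set" assume S: "open S"
  interpret M: Metric_space "convex_bodies :: (real^'a) set set" hausdorff_dist
    by (rule Metric_space_convex_bodies)
  have sub: "{T. openin M.mtopology T} \<subseteq> Pow convex_bodies"
    using openin_subset by fastforce
  define T where "T = (\<lambda>K. set_support K u) -` S \<inter> convex_bodies"
  have "openin M.mtopology T"
    unfolding M.openin_mtopology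
  proof (intro conjI ballI allI impI)
    show "T \<subseteq> convex_bodies" by (auto simp: T_def)
    fix K assume K: "K \<in> T"
    then obtain e where e: "0 < e" "\<And>y. dist y (set_support K u) < e \<Longrightarrow> y \<in> S"
      using S by (auto simp: T_def open_dist)
    have "M.mball K e \<subseteq> T"
    proof
      fix L assume "L \<in> M.mball K e"
      then have L: "L \<in> convex_bodies" "hausdorff_dist K L < e" by auto
      have KK: "K \<in> convex_bodies" using K by (simp add: T_def)
      have "dist (set_support L u) (set_support K u) < e"
        using set_support_diff_le_hausdorff[OF KK L(1) u] L(2) by (simp add: dist_real_def)
      then show "L \<in> T" using e(2) L(1) by (auto simp: T_def)
    qed
    then show "\<exists>r>0. M.mball K r \<subseteq> T" using e(1) by blast
  qed
  then show "(\<lambda>K. set_support K u) -` S \<inter> space convex_bodies_borel \<in> sets convex_bodies_borel"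
    using sub by (auto simp: convex_bodies_borel_def space_measure_of_conv sets_measure_of T_def)
qed

lemma support_fun_measurable:
  assumes "X \<in> fuzzy_random_variables P" "\<alpha> \<in> {0..1}" "norm u = 1"
  shows "(\<lambda>\<omega>. support_fun (X \<omega>) u \<alpha>) \<in> borel_measurable P"
  unfolding support_fun_eq
  using assms by (intro measurable_compose[OF _ set_support_measurable])
    (auto simp: fuzzy_random_variables_def)

section \<open>Medians\<close>

context prob_space
begin

lemma medians_cong:
  assumes "\<And>\<omega>. \<omega> \<in> space M \<Longrightarrow> Y \<omega> = Z \<omega>" shows "medians M Y = medians M Z"
proof -
  have "{\<omega> \<in> space M. Y \<omega> \<le> m} = {\<omega> \<in> space M. Z \<omega> \<le> m}"
    "{\<omega> \<in> space M. Y \<omega> \<ge> m} = {\<omega> \<in> space M. Z \<omega> \<ge> m}" for m using assms by auto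
  then show ?thesis by (simp add: medians_def)
qed

text \<open>
  Medians depend on the distribution only.
\<close>

lemma medians_distr:
  assumes [measurable]: "Y \<in> borel_measurable M"
  shows "medians M Y =
    {m. measure (distr M borel Y) {..m} \<ge> 1 / 2 \<and> measure (distr M borel Y) {m..} \<ge> 1 / 2}"
proof -
  have "Y -` {..m} \<inter> space M = {\<omega> \<in> space M. Y \<omega> \<le> m}"
    "Y -` {m..} \<inter> space M = {\<omega> \<in> space M. Y \<omega> \<ge> m}" for m by auto
  then show ?thesis by (simp add: medians_def measure_distr)
qed

text \<open>
  The smallest point at which the distribution function reaches \<open>1/2\<close> is a median: right continuity
  gives the bound for \<open>{..m}\<close>, and the left limit, being at most \<open>1/2\<close>, gives the one for \<open>{m..}\<close>.
\<close>

lemma medians_nonempty: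
  assumes Y[measurable]: "Y \<in> borel_measurable M"
  shows "medians M Y \<noteq> {}"
proof -
  define D where "D = distr M borel Y"
  interpret D: real_distribution D
    unfolding D_def by (rule real_distribution_distr[OF Y])
  define S where "S = {x. cdf D x \<ge> 1 / 2}"
  have "eventually (\<lambda>x. cdf D x > 1 / 2) at_top"
    using order_tendstoD(1)[OF D.cdf_lim_at_top_prob, of "1/2"] by simp
  then have "\<exists>x. cdf D x > 1 / 2" by (intro eventually_happens') auto
  then obtain x\<^sub>0 where "cdf D x\<^sub>0 > 1 / 2" by blast
  then have "x\<^sub>0 \<in> S" unfolding S_def by (intro CollectI less_imp_le)
  then have "S \<noteq> {}" by blast
  have "eventually (\<lambda>x. cdf D x < 1 / 2) at_bot"
    using order_tendstoD(2)[OF D.cdf_lim_at_bot, of "1/2"] by simp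
  then obtain l where l: "\<And>x. x \<le> l \<Longrightarrow> cdf D x < 1 / 2"
    by (auto simp: eventually_at_bot_linorder)
  have bdd: "bdd_below S"
  proof (rule bdd_belowI[of _ l])
    fix x assume "x \<in> S" then show "l \<le> x" using l[of x] by (cases "x \<le> l") (auto simp: S_def)
  qed
  define m where "m = Inf S"
  have above: "cdf D x \<ge> 1 / 2" if mx: "m < x" for x
  proof -
    obtain y where "y \<in> S" "y < x"
      using cInf_lessD[OF \<open>S \<noteq> {}\<close>, of x] mx unfolding m_def by blast
    then show ?thesis using D.cdf_nondecreasing[of y x] by (auto simp: S_def)
  qed
  have below: "cdf D x < 1 / 2" if "x < m" for x
    using cInf_lower[OF _ bdd, of x] that by (force simp: m_def S_def)
  have "(cdf D \<longlongrightarrow> cdf D m) (at_right m)"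
    using D.cdf_is_right_cont[of m] by (simp add: continuous_within)
  moreover have "\<forall>\<^sub>F x in at_right m. 1 / 2 \<le> cdf D x"
    unfolding eventually_at_filter by (intro always_eventually allI impI above) simp
  ultimately have "cdf D m \<ge> 1 / 2" by (rule tendsto_lowerbound) simp
  moreover have "\<forall>\<^sub>F x in at_left m. cdf D x \<le> 1 / 2"
    unfolding eventually_at_filter by (intro always_eventually allI impI less_imp_le below) simp
  with D.cdf_at_left[of m] have "measure D {..<m} \<le> 1 / 2" by (rule tendsto_upperbound) simp
  then have "measure D {m..} \<ge> 1 / 2"
    using D.prob_compl[of "{..<m}"] by (simp add: Compl_eq_Diff_UNIV[symmetric])
  ultimately have "m \<in> medians M Y"
    by (simp add: medians_distr[OF Y] D_def[symmetric] cdf_def)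
  then show ?thesis by blast
qed

lemma medians_subset:
  assumes Y[measurable]: "Y \<in> borel_measurable M"
    and R: "prob {\<omega> \<in> space M. a \<le> Y \<omega> \<and> Y \<omega> \<le> b} > 1 / 2"
  shows "medians M Y \<subseteq> {a..b}"
proof
  fix m assume m: "m \<in> medians M Y"
  let ?E = "{\<omega> \<in> space M. a \<le> Y \<omega> \<and> Y \<omega> \<le> b}"
  have compl: "prob F < 1 / 2" if "F \<in> events" "F \<subseteq> space M - ?E" for F
  proof -
    have "prob F \<le> prob (space M - ?E)" using that by (intro finite_measure_mono) auto
    then show ?thesis using R prob_compl[of ?E] by simp
  qed
  have "\<not> m < a"
  proof
    assume "m < a"
    then have "prob {\<omega> \<in> space M. Y \<omega> \<le> m} < 1 / 2" by (intro compl) auto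
    then show False using m by (simp add: medians_def)
  qed
  moreover have "\<not> b < m"
  proof
    assume "b < m"
    then have "prob {\<omega> \<in> space M. Y \<omega> \<ge> m} < 1 / 2" by (intro compl) auto
    then show False using m by (simp add: medians_def)
  qed
  ultimately show "m \<in> {a..b}" by simp
qed

lemma exists_likely_bound:
  fixes Y :: "'a \<Rightarrow> real"
  assumes Y[measurable]: "Y \<in> borel_measurable M"
  shows "\<exists>R>0. prob {\<omega> \<in> space M. \<bar>Y \<omega>\<bar> \<le> R} > 1 / 2"
proof -
  have "(\<lambda>n. prob {\<omega> \<in> space M. \<bar>Y \<omega>\<bar> \<le> real n}) \<longlonglongrightarrow>
      prob (\<Union>n. {\<omega> \<in> space M. \<bar>Y \<omega>\<bar> \<le> real n})"
    by (intro finite_Lim_measure_incseq) (auto simp: incseq_def)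
  also have "(\<Union>n. {\<omega> \<in> space M. \<bar>Y \<omega>\<bar> \<le> real n}) = space M"
    using real_arch_simple by auto
  finally have "eventually (\<lambda>n. prob {\<omega> \<in> space M. \<bar>Y \<omega>\<bar> \<le> real n} > 1 / 2) sequentially"
    by (intro order_tendstoD(1)) (auto simp: prob_space)
  then obtain n where "prob {\<omega> \<in> space M. \<bar>Y \<omega>\<bar> \<le> real n} > 1 / 2"
    using eventually_happens'[of sequentially] by auto
  moreover have "prob {\<omega> \<in> space M. \<bar>Y \<omega>\<bar> \<le> real n} \<le> prob {\<omega> \<in> space M. \<bar>Y \<omega>\<bar> \<le> real n + 1}"
    by (intro finite_measure_mono) auto
  ultimately show ?thesis by (intro exI[of _ "real n + 1"]) auto
qed

lemma medians_bounded:
  assumes Y: "Y \<in> borel_measurable M"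
  shows "bdd_below (medians M Y)" "bdd_above (medians M Y)"
proof -
  obtain R where R: "prob {\<omega> \<in> space M. \<bar>Y \<omega>\<bar> \<le> R} > 1 / 2"
    using exists_likely_bound[OF Y] by blast
  then have "medians M Y \<subseteq> {-R..R}"
    by (intro medians_subset[OF Y]) (simp add: abs_le_iff minus_le_iff conj_commute)
  then show "bdd_below (medians M Y)" "bdd_above (medians M Y)"
    by (meson bdd_above_Icc bdd_above_mono bdd_below_Icc bdd_below_mono)+
qed

lemma med_bounds:
  assumes Y: "Y \<in> borel_measurable M" and sub: "medians M Y \<subseteq> {a..b}"
  shows "med M Y \<in> {a..b}"
proof -
  have ne: "medians M Y \<noteq> {}" by (rule medians_nonempty[OF Y])
  then obtain m where m: "m \<in> medians M Y" by blast
  have "a \<le> Inf (medians M Y)" "Sup (medians M Y) \<le> b"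
    using sub by (auto intro!: cInf_greatest cSup_least ne)
  moreover have "Inf (medians M Y) \<le> m" "m \<le> Sup (medians M Y)"
    using m medians_bounded[OF Y] by (auto intro!: cInf_lower cSup_upper)
  ultimately show ?thesis using m sub by (auto simp: med_def)
qed

lemma med_nonneg:
  assumes Y: "Y \<in> borel_measurable M" and nonneg: "\<And>\<omega>. \<omega> \<in> space M \<Longrightarrow> 0 \<le> Y \<omega>"
  shows "0 \<le> med M Y"
proof -
  have "0 \<le> m" if m: "m \<in> medians M Y" for m
  proof (rule ccontr)
    assume "\<not> 0 \<le> m"
    then have "{\<omega> \<in> space M. Y \<omega> \<le> m} = {}" using nonneg by fastforce
    then have "prob {\<omega> \<in> space M. Y \<omega> \<le> m} = 0" by (simp only: measure_empty)
    then show False using m by (simp add: medians_def)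
  qed
  then have "medians M Y \<subseteq> {0..Sup (medians M Y)}"
    using medians_bounded[OF Y] by (auto intro: cSup_upper)
  from med_bounds[OF Y this] show ?thesis by simp
qed

lemma medians_affine:
  assumes a: "a > 0"
  shows "medians M (\<lambda>\<omega>. a * Y \<omega> + b) = (\<lambda>x. a * x + b) ` medians M Y"
proof -
  have iff: "a * Y \<omega> + b \<le> m \<longleftrightarrow> Y \<omega> \<le> (m - b) / a"
    "m \<le> a * Y \<omega> + b \<longleftrightarrow> (m - b) / a \<le> Y \<omega>" for \<omega> m
    using a by (auto simp: field_simps)
  have "m \<in> (\<lambda>x. a * x + b) ` medians M Y \<longleftrightarrow> (m - b) / a \<in> medians M Y" for m
    using a by (auto simp: image_iff intro!: bexI[of _ "(m - b) / a"])
  then show ?thesis unfolding medians_def iff by auto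
qed

text \<open>
  \<open>Inf\<close> and \<open>Sup\<close> commute with the increasing continuous map because the set of medians is non-empty
  and bounded.
\<close>

lemma med_affine:
  assumes Y: "Y \<in> borel_measurable M" and a: "a > 0"
  shows "med M (\<lambda>\<omega>. a * Y \<omega> + b) = a * med M Y + b"
proof -
  note ne = medians_nonempty[OF Y] and bdd = medians_bounded[OF Y]
  have m: "mono (\<lambda>x. a * x + b)" using a by (auto intro!: monoI)
  have c: "continuous (at x within F) (\<lambda>x. a * x + b)" for x F by (intro continuous_intros)
  show ?thesis
    unfolding med_def medians_affine[OF a]
      continuous_at_Inf_mono[OF m c ne bdd(1), symmetric]
      continuous_at_Sup_mono[OF m c ne bdd(2), symmetric]
    by (simp add: field_simps)
qed

lemma MAD_affine:
  assumes Y[measurable]: "Y \<in> borel_measurable M" and a: "a > 0"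
  shows "MAD M (\<lambda>\<omega>. a * Y \<omega> + b) = a * MAD M Y"
proof -
  have "\<bar>a * Y \<omega> + b - (a * med M Y + b)\<bar> = a * \<bar>Y \<omega> - med M Y\<bar> + 0" for \<omega>
    using a by (simp add: abs_mult right_diff_distrib[symmetric])
  moreover have "med M (\<lambda>\<omega>. a * \<bar>Y \<omega> - med M Y\<bar> + 0) = a * med M (\<lambda>\<omega>. \<bar>Y \<omega> - med M Y\<bar>) + 0"
    by (rule med_affine[OF _ a]) measurable
  ultimately show ?thesis
    unfolding MAD_def med_affine[OF Y a] by simp
qed

lemma MAD_nonneg:
  assumes [measurable]: "Y \<in> borel_measurable M" shows "0 \<le> MAD M Y"
  unfolding MAD_def by (rule med_nonneg) auto

lemma med_MAD_bound:
  assumes Y[measurable]: "Y \<in> borel_measurable M" and R: "prob {\<omega> \<in> space M. \<bar>Y \<omega>\<bar> \<le> R} > 1 / 2"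
  shows "\<bar>med M Y\<bar> \<le> R" "MAD M Y \<le> 2 * R"
proof -
  have "medians M Y \<subseteq> {-R..R}"
    using R by (intro medians_subset[OF Y]) (simp add: abs_le_iff minus_le_iff conj_commute)
  from med_bounds[OF Y this] show m: "\<bar>med M Y\<bar> \<le> R" by auto
  have "prob {\<omega> \<in> space M. \<bar>Y \<omega>\<bar> \<le> R} \<le>
      prob {\<omega> \<in> space M. 0 \<le> \<bar>Y \<omega> - med M Y\<bar> \<and> \<bar>Y \<omega> - med M Y\<bar> \<le> 2 * R}"
    using m by (intro finite_measure_mono) auto
  with R have "medians M (\<lambda>\<omega>. \<bar>Y \<omega> - med M Y\<bar>) \<subseteq> {0..2 * R}"
    by (intro medians_subset) auto
  then show "MAD M Y \<le> 2 * R" unfolding MAD_def using med_bounds[of "\<lambda>\<omega>. \<bar>Y \<omega> - med M Y\<bar>"] by auto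
qed

text \<open>
  The set of medians of \<open>Y - c\<close> is symmetric about \<open>0\<close>, hence so is its midpoint.
\<close>

lemma med_symmetric:
  assumes Y[measurable]: "Y \<in> borel_measurable M"
    and sym: "distr M borel (\<lambda>\<omega>. c - Y \<omega>) = distr M borel (\<lambda>\<omega>. Y \<omega> - c)"
  shows "med M Y = c"
proof -
  define S where "S = medians M (\<lambda>\<omega>. Y \<omega> - c)"
  have "medians M (\<lambda>\<omega>. c - Y \<omega>) = S"
    by (simp add: S_def medians_distr sym)
  moreover have "m \<in> medians M (\<lambda>\<omega>. c - Y \<omega>) \<longleftrightarrow> - m \<in> S" for m
  proof -
    have "c - Y \<omega> \<le> m \<longleftrightarrow> - m \<le> Y \<omega> - c" "m \<le> c - Y \<omega> \<longleftrightarrow> Y \<omega> - c \<le> - m" for \<omega> by auto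
    then show ?thesis by (auto simp: S_def medians_def)
  qed
  ultimately have "uminus ` S = S" by (force simp: image_iff)
  then have "Inf S = - Sup S" by (metis Inf_real_def)
  then have "med M (\<lambda>\<omega>. Y \<omega> - c) = 0" by (simp add: med_def S_def)
  then show ?thesis using med_affine[OF Y, of 1 "- c"] by simp
qed

end

section \<open>Outlyingness\<close>

text \<open>
  Centre and unit of the outlyingness at \<open>(u, \<alpha>)\<close>.
\<close>

abbreviation "support_med P X u \<alpha> \<equiv> med P (\<lambda>\<omega>. support_fun (X \<omega>) u \<alpha>)"
abbreviation "support_MAD P X u \<alpha> \<equiv> MAD P (\<lambda>\<omega>. support_fun (X \<omega>) u \<alpha>)"

lemma outlyingness_upper:
  assumes "norm u = 1" "\<alpha> \<in> {0..1}"
  shows "ennreal \<bar>support_fun A u \<alpha> - support_med P X u \<alpha>\<bar> / ennreal (support_MAD P X u \<alpha>) \<le> outlyingness P A X"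
  unfolding outlyingness_def using assms by (intro SUP_upper2[of "(u, \<alpha>)"]) auto

lemma outlyingness_least:
  assumes "\<And>u \<alpha>. norm u = 1 \<Longrightarrow> \<alpha> \<in> {0..1} \<Longrightarrow>
    ennreal \<bar>support_fun A u \<alpha> - support_med P X u \<alpha>\<bar> / ennreal (support_MAD P X u \<alpha>) \<le> c"
  shows "outlyingness P A X \<le> c"
  unfolding outlyingness_def using assms by (intro SUP_least) auto

lemma D_FP_real:
  "outlyingness P A X = top \<Longrightarrow> D_FP P A X = 0"
  "outlyingness P A X = ennreal r \<Longrightarrow> 0 \<le> r \<Longrightarrow> D_FP P A X = 1 / (1 + r)"
  by (auto simp: D_FP_def inverse_ennreal inverse_eq_divide simp flip: ennreal_1 ennreal_plus)

lemma D_FP_le_iff: "D_FP P B X \<le> D_FP P A Y \<longleftrightarrow> outlyingness P A Y \<le> outlyingness P B X"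
proof (cases "outlyingness P A Y" rule: ennreal_cases; cases "outlyingness P B X" rule: ennreal_cases)
  fix r q :: real
  assume "0 \<le> r" "outlyingness P A Y = ennreal r" "0 \<le> q" "outlyingness P B X = ennreal q"
  then show ?thesis by (simp add: D_FP_real frac_le_eq divide_le_0_iff field_simps)
qed (auto simp: D_FP_real top_unique divide_le_0_iff D_FP_bounds)

lemma bdd_above_D_FP: "bdd_above ((\<lambda>B. D_FP P B X) ` S)"
  using D_FP_bounds(2) by (intro bdd_aboveI2)

text \<open>
  Only quasi-convexity of \<open>s \<mapsto> |s - m|\<close> is used, which spares any arithmetic with infinite ratios.
\<close>

lemma outlyingness_between:
  fixes X :: "'w \<Rightarrow> (real^'n) \<Rightarrow> real"
  assumes g: "\<gamma> \<in> {0..1}"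
    and C: "\<And>u \<alpha>. norm u = 1 \<Longrightarrow> \<alpha> \<in> {0..1} \<Longrightarrow>
      support_fun C u \<alpha> = (1 - \<gamma>) * support_fun A u \<alpha> + \<gamma> * support_fun B u \<alpha>"
  shows "outlyingness P C X \<le> max (outlyingness P A X) (outlyingness P B X)"
proof (rule outlyingness_least)
  fix u :: "real^'n" and \<alpha> :: real assume u: "norm u = 1" and \<alpha>: "\<alpha> \<in> {0..1}"
  define m where "m = support_med P X u \<alpha>"
  let ?a = "\<bar>support_fun A u \<alpha> - m\<bar>" and ?b = "\<bar>support_fun B u \<alpha> - m\<bar>"
  have "support_fun C u \<alpha> - m = (1 - \<gamma>) * (support_fun A u \<alpha> - m) + \<gamma> * (support_fun B u \<alpha> - m)"
    using C[OF u \<alpha>] by (simp add: algebra_simps)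
  then have "\<bar>support_fun C u \<alpha> - m\<bar> \<le> (1 - \<gamma>) * ?a + \<gamma> * ?b"
    using g abs_triangle_ineq[of "(1 - \<gamma>) * (support_fun A u \<alpha> - m)" "\<gamma> * (support_fun B u \<alpha> - m)"]
    by (simp add: abs_mult)
  also have "\<dots> \<le> max ?a ?b" using g by (intro convex_bound_le) auto
  finally have "ennreal \<bar>support_fun C u \<alpha> - m\<bar> \<le> max (ennreal ?a) (ennreal ?b)"
    by (simp add: ennreal_leI max_def split: if_splits)
  then have "ennreal \<bar>support_fun C u \<alpha> - m\<bar> / ennreal (support_MAD P X u \<alpha>)
      \<le> max (ennreal ?a) (ennreal ?b) / ennreal (support_MAD P X u \<alpha>)"
    by (rule divide_right_mono_ennreal)
  also have "\<dots> \<le> max (outlyingness P A X) (outlyingness P B X)"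
    using outlyingness_upper[OF u \<alpha>, of A P X] outlyingness_upper[OF u \<alpha>, of B P X]
    by (auto simp: m_def max_def intro: order_trans)
  finally show "ennreal \<bar>support_fun C u \<alpha> - support_med P X u \<alpha>\<bar> / ennreal (support_MAD P X u \<alpha>)
      \<le> max (outlyingness P A X) (outlyingness P B X)" by (simp add: m_def)
qed

text \<open>
  The lower bound covers \<open>m = 0\<close> as well, where the quotient is infinite because \<open>x > 0\<close>.
\<close>

lemma ennreal_divide_ge:
  assumes "0 < K" "0 \<le> m" "m \<le> b" "0 < b" "K * b \<le> x"
  shows "ennreal K \<le> ennreal x / ennreal m"
proof (cases "m = 0")
  case True
  have "0 < x" using assms mult_pos_pos[of K b] by linarith
  then show ?thesis using True by (simp add: ennreal_conventions)
next
  case False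
  have "K * m \<le> x" using assms mult_left_mono[of m b K] by linarith
  then have "K \<le> x / m" using False assms by (simp add: field_simps)
  moreover have "0 \<le> x" using assms mult_pos_pos[of K b] by linarith
  ultimately show ?thesis using False assms by (simp add: divide_ennreal ennreal_leI)
qed

text \<open>
  The depth of an outlyingness at least \<open>K\<close> is at most \<open>1 / (1 + K)\<close>.
\<close>

lemma D_FP_tendsto_0:
  assumes "\<And>K. 0 < K \<Longrightarrow> eventually (\<lambda>i. ennreal K \<le> outlyingness P (A i) X) F"
  shows "((\<lambda>i. D_FP P (A i) X) \<longlongrightarrow> 0) F"
proof (rule tendstoI)
  fix e :: real assume e: "0 < e"
  show "\<forall>\<^sub>F i in F. dist (D_FP P (A i) X) 0 < e"
    using assms[of "1 / e"]
  proof (rule eventually_mono)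
    fix i assume ge: "ennreal (1 / e) \<le> outlyingness P (A i) X"
    have "D_FP P (A i) X \<le> 1 / (1 + 1 / e)"
    proof (cases "outlyingness P (A i) X" rule: ennreal_cases)
      case (real r)
      then have "1 / e \<le> r" using ge by simp
      then show ?thesis using e real by (auto simp: D_FP_real intro!: divide_left_mono mult_pos_pos add_pos_nonneg)
    qed (use e in \<open>simp add: D_FP_real\<close>)
    also have "\<dots> < e" using e by (simp add: field_simps)
    finally show "dist (D_FP P (A i) X) 0 < e" using D_FP_bounds(1)[of P "A i" X] by (simp add: dist_real_def)
  qed (use e in simp)
qed

section \<open>Affine equivariance\<close>

text \<open>
  With \<open>c = |T\<^sup>T u|\<close>, the support functions of the transformed fuzzy sets at \<open>(u, \<alpha>)\<close> are \<open>c\<close> times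
  the original ones at \<open>(\<phi> u, \<alpha>)\<close>, up to the common shift \<open>support_fun V u \<alpha>\<close>. The shift cancels in
  the numerator and does not affect \<open>MAD\<close>; the factor \<open>c\<close> cancels in the quotient.
\<close>

lemma outlyingness_affine:
  fixes T :: "real^'n^'n"
  assumes P: "prob_space P" and T: "invertible T" and U: "U \<in> fuzzy_sets" and V: "V \<in> fuzzy_sets"
    and X: "X \<in> fuzzy_random_variables P"
  shows "outlyingness P (fuzzy_add (fuzzy_matrix T U) V) (\<lambda>\<omega>. fuzzy_add (fuzzy_matrix T (X \<omega>)) V)
    = outlyingness P U X"
proof -
  interpret prob_space P by (rule P)
  let ?S = "transpose T"
  let ?X = "\<lambda>\<omega>. fuzzy_add (fuzzy_matrix T (X \<omega>)) V" and ?U = "fuzzy_add (fuzzy_matrix T U) V"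
  define \<phi> where "\<phi> u = (?S *v u) /\<^sub>R norm (?S *v u)" for u
  have inv: "invertible ?S" using T by (rule transpose_invertible)
  have inj: "?S *v u \<noteq> 0" if "u \<noteq> 0" for u
    using inv that by (metis matrix_left_invertible_ker invertible_left_inverse)
  have mF: "fuzzy_matrix T A \<in> fuzzy_sets" if "A \<in> fuzzy_sets" for A
    unfolding fuzzy_matrix_eq_zadeh by (rule zadeh_linear_fuzzy_set[OF that matrix_vector_mul_linear])
  have s: "support_fun (fuzzy_add (fuzzy_matrix T A) V) u \<alpha> =
      norm (?S *v u) * support_fun A (\<phi> u) \<alpha> + support_fun V u \<alpha>"
    if "A \<in> fuzzy_sets" "norm u = 1" "\<alpha> \<in> {0..1}" for A u \<alpha>
  proof -
    have "u \<noteq> 0" using that(2) by auto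
    then have "norm (?S *v u) \<noteq> 0" using inj[of u] by simp
    then have "?S *v u = norm (?S *v u) *\<^sub>R \<phi> u" by (simp add: \<phi>_def)
    then show ?thesis
      using support_fun_scaleR[OF that(1,3), of "norm (?S *v u)" "\<phi> u"]
      by (simp add: support_fun_fuzzy_add[OF mF[OF that(1)] V that(3)] support_fun_fuzzy_matrix[OF that(1,3)])
  qed
  have ratio: "ennreal \<bar>support_fun ?U u \<alpha> - support_med P ?X u \<alpha>\<bar> / ennreal (support_MAD P ?X u \<alpha>) =
      ennreal \<bar>support_fun U (\<phi> u) \<alpha> - support_med P X (\<phi> u) \<alpha>\<bar> / ennreal (support_MAD P X (\<phi> u) \<alpha>)"
    and \<phi>: "norm (\<phi> u) = 1" if u: "norm u = 1" and \<alpha>: "\<alpha> \<in> {0..1}" for u \<alpha>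
  proof -
    define c where "c = norm (?S *v u)"
    have "u \<noteq> 0" using u by auto
    then have c: "0 < c" using inj[of u] by (simp add: c_def)
    show \<phi>: "norm (\<phi> u) = 1" using c by (simp add: \<phi>_def c_def)
    define Y where "Y \<omega> = support_fun (X \<omega>) (\<phi> u) \<alpha>" for \<omega>
    have Y[measurable]: "Y \<in> borel_measurable P"
      unfolding Y_def by (rule support_fun_measurable[OF X \<alpha> \<phi>])
    have eq: "support_fun (?X \<omega>) u \<alpha> = c * Y \<omega> + support_fun V u \<alpha>" if "\<omega> \<in> space P" for \<omega>
      using X that s[of "X \<omega>" u \<alpha>] u \<alpha> by (simp add: fuzzy_random_variables_def c_def Y_def)
    have medX: "support_med P ?X u \<alpha> = c * med P Y + support_fun V u \<alpha>"
      using medians_cong[OF eq] med_affine[OF Y c, of "support_fun V u \<alpha>"] by (simp add: med_def)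
    have "support_MAD P ?X u \<alpha> = MAD P (\<lambda>\<omega>. c * Y \<omega> + support_fun V u \<alpha>)"
    proof -
      have "medians P (\<lambda>\<omega>. \<bar>support_fun (?X \<omega>) u \<alpha> - (c * med P Y + support_fun V u \<alpha>)\<bar>) =
          medians P (\<lambda>\<omega>. \<bar>c * Y \<omega> + support_fun V u \<alpha> - (c * med P Y + support_fun V u \<alpha>)\<bar>)"
        by (rule medians_cong) (simp only: eq)
      then show ?thesis unfolding MAD_def medX med_affine[OF Y c] by (simp add: med_def)
    qed
    then have MADX: "support_MAD P ?X u \<alpha> = c * MAD P Y" using MAD_affine[OF Y c] by simp
    have "\<bar>support_fun ?U u \<alpha> - support_med P ?X u \<alpha>\<bar> = c * \<bar>support_fun U (\<phi> u) \<alpha> - med P Y\<bar>"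
      using c unfolding medX s[OF U u \<alpha>] c_def[symmetric]
      by (simp add: right_diff_distrib[symmetric] abs_mult)
    moreover have "ennreal (c * x) / ennreal (c * y) = ennreal x / ennreal y" if "0 \<le> x" "0 \<le> y" for x y
    proof (cases "y = 0")
      case True
      then show ?thesis using that c by (cases "x = 0") (auto simp: ennreal_conventions)
    qed (use that c in \<open>auto simp: divide_ennreal\<close>)
    ultimately show "ennreal \<bar>support_fun ?U u \<alpha> - support_med P ?X u \<alpha>\<bar> / ennreal (support_MAD P ?X u \<alpha>) =
      ennreal \<bar>support_fun U (\<phi> u) \<alpha> - support_med P X (\<phi> u) \<alpha>\<bar> / ennreal (support_MAD P X (\<phi> u) \<alpha>)"
      using MAD_nonneg[OF Y] by (simp add: MADX Y_def[symmetric])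
  qed
  show ?thesis
  proof (rule antisym)
    show "outlyingness P ?U ?X \<le> outlyingness P U X"
      by (rule outlyingness_least) (simp only: ratio outlyingness_upper \<phi>)
    show "outlyingness P U X \<le> outlyingness P ?U ?X"
    proof (rule outlyingness_least)
      fix w :: "real^'n" and \<alpha> :: real assume w: "norm w = 1" and \<alpha>: "\<alpha> \<in> {0..1}"
      \<comment> \<open>\<open>\<phi>\<close> is onto: the direction of \<open>R w\<close> is mapped to \<open>w\<close>.\<close>
      obtain R where R: "?S ** R = mat 1" using inv by (auto simp: invertible_def)
      define v where "v = R *v w"
      have Sv: "?S *v v = w" by (simp add: v_def matrix_vector_mul_assoc R)
      then have "v \<noteq> 0" using w by auto
      define u where "u = v /\<^sub>R norm v"
      have u: "norm u = 1" using \<open>v \<noteq> 0\<close> by (simp add: u_def)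
      have "?S *v u = w /\<^sub>R norm v" using Sv by (simp add: u_def matrix_vector_mult_scaleR)
      then have "\<phi> u = w" using w \<open>v \<noteq> 0\<close> by (simp add: \<phi>_def)
      then show "ennreal \<bar>support_fun U w \<alpha> - support_med P X w \<alpha>\<bar> / ennreal (support_MAD P X w \<alpha>) \<le> outlyingness P ?U ?X"
        using ratio[OF u \<alpha>] outlyingness_upper[OF u \<alpha>, of ?U P ?X] by simp
    qed
  qed
qed

section \<open>Symmetry\<close>

lemma outlyingness_symmetric:
  assumes P: "prob_space P" and X: "X \<in> fuzzy_random_variables P" and sym: "F_symmetric P X U"
  shows "outlyingness P U X = 0"
proof -
  interpret prob_space P by (rule P)
  have "support_med P X u \<alpha> = support_fun U u \<alpha>" if "norm u = 1" "\<alpha> \<in> {0..1}" for u \<alpha>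
    using that sym support_fun_measurable[OF X that(2,1)]
    by (intro med_symmetric) (auto simp: F_symmetric_def)
  then have "outlyingness P U X \<le> 0" by (intro outlyingness_least) (simp add: ennreal_conventions)
  then show ?thesis by simp
qed

section \<open>Vanishing at infinity\<close>

text \<open>
  All support values are dominated by the random variable \<open>Z\<close>. If \<open>Z \<le> R\<close> with probability above
  \<open>1/2\<close>, then every median lies in \<open>[-R, R]\<close> and every \<open>MAD\<close> is at most \<open>2 R\<close>.
\<close>

lemma support_med_MAD_uniformly_bounded:
  fixes X :: "'w \<Rightarrow> (real^'n) \<Rightarrow> real"
  assumes P: "prob_space P" and X: "X \<in> fuzzy_random_variables P"
  shows "\<exists>R>0. \<forall>u \<alpha>. norm u = 1 \<longrightarrow> \<alpha> \<in> {0..1} \<longrightarrow>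
    \<bar>support_med P X u \<alpha>\<bar> \<le> R \<and> 0 \<le> support_MAD P X u \<alpha> \<and> support_MAD P X u \<alpha> \<le> R"
proof -
  interpret prob_space P by (rule P)
  define Z where
    "Z \<omega> = (\<Sum>b\<in>(Basis :: (real^'n) set). \<bar>support_fun (X \<omega>) b 0\<bar> + \<bar>support_fun (X \<omega>) (- b) 0\<bar>)" for \<omega>
  note m[measurable] = support_fun_measurable[OF X]
  have Z[measurable]: "Z \<in> borel_measurable P"
    unfolding Z_def by (intro borel_measurable_sum borel_measurable_add borel_measurable_abs m) auto
  obtain R where R: "0 < R" "prob {\<omega> \<in> space P. \<bar>Z \<omega>\<bar> \<le> R} > 1 / 2"
    using exists_likely_bound[OF Z] by blast
  have "\<bar>support_med P X u \<alpha>\<bar> \<le> R \<and> 0 \<le> support_MAD P X u \<alpha> \<and> support_MAD P X u \<alpha> \<le> 2 * R"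
    if u: "norm u = 1" and \<alpha>: "\<alpha> \<in> {0..1}" for u \<alpha>
  proof -
    note Y[measurable] = m[OF \<alpha> u]
    have "\<bar>support_fun (X \<omega>) u \<alpha>\<bar> \<le> \<bar>Z \<omega>\<bar>" if "\<omega> \<in> space P" for \<omega>
      using support_fun_coordinate_bound[of "X \<omega>" \<alpha> u] X that u \<alpha>
      by (auto simp: fuzzy_random_variables_def Z_def)
    then have "prob {\<omega> \<in> space P. \<bar>Z \<omega>\<bar> \<le> R} \<le> prob {\<omega> \<in> space P. \<bar>support_fun (X \<omega>) u \<alpha>\<bar> \<le> R}"
      by (intro finite_measure_mono) (auto intro: order_trans)
    with R(2) have "prob {\<omega> \<in> space P. \<bar>support_fun (X \<omega>) u \<alpha>\<bar> \<le> R} > 1 / 2" by simp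
    from med_MAD_bound[OF Y this] MAD_nonneg[OF Y] show ?thesis by simp
  qed
  then show ?thesis using R(1) by (intro exI[of _ "2 * R"]) (force)
qed

text \<open>
  Since \<open>U \<noteq> indicator {0}\<close>, some \<open>(u, \<alpha>)\<close> has \<open>support_fun U u \<alpha> \<noteq> 0\<close>; there the numerator grows
  linearly in \<open>\<gamma>\<close> while the denominator is fixed.
\<close>

lemma D_FP_ray_tendsto_0:
  assumes P: "prob_space P" and X: "X \<in> fuzzy_random_variables P"
    and A: "A \<in> fuzzy_sets" and U: "U \<in> fuzzy_sets" "U \<noteq> indicator {0}"
  shows "((\<lambda>\<gamma>. D_FP P (fuzzy_add A (fuzzy_scale \<gamma> U)) X) \<longlongrightarrow> 0) at_top"
proof -
  interpret prob_space P by (rule P)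
  obtain u \<alpha> where u: "norm u = 1" and \<alpha>: "\<alpha> \<in> {0..1}" and nz: "support_fun U u \<alpha> \<noteq> 0"
    using fuzzy_set_eq_indicator_zero[OF U(1)] U(2) by blast
  define q where "q = \<bar>support_fun U u \<alpha>\<bar>"
  define a where "a = \<bar>support_fun A u \<alpha> - support_med P X u \<alpha>\<bar>"
  have q: "0 < q" using nz by (simp add: q_def)
  have MAD0: "0 \<le> support_MAD P X u \<alpha>" by (rule MAD_nonneg[OF support_fun_measurable[OF X \<alpha> u]])
  show ?thesis
  proof (rule D_FP_tendsto_0)
    fix K :: real assume K: "0 < K"
    let ?b = "support_MAD P X u \<alpha> + 1"
    show "\<forall>\<^sub>F \<gamma> in at_top. ennreal K \<le> outlyingness P (fuzzy_add A (fuzzy_scale \<gamma> U)) X"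
      using eventually_ge_at_top[of 0] eventually_ge_at_top[of "(K * ?b + a) / q"]
    proof eventually_elim
      fix \<gamma> :: real assume g: "0 \<le> \<gamma>" "(K * ?b + a) / q \<le> \<gamma>"
      have gU: "fuzzy_scale \<gamma> U \<in> fuzzy_sets"
        unfolding fuzzy_scale_eq_zadeh by (rule zadeh_linear_fuzzy_set[OF U(1) linear_scale_self])
      define x where "x = support_fun (fuzzy_add A (fuzzy_scale \<gamma> U)) u \<alpha> - support_med P X u \<alpha>"
      have "x = (support_fun A u \<alpha> - support_med P X u \<alpha>) + \<gamma> * support_fun U u \<alpha>"
        using support_fun_fuzzy_add[OF A gU \<alpha>] support_fun_fuzzy_scale[OF U(1) \<alpha> g(1)] by (simp add: x_def)
      moreover have "\<bar>\<gamma> * support_fun U u \<alpha>\<bar> = \<gamma> * q" using g by (simp add: abs_mult q_def)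
      ultimately have "\<gamma> * q - a \<le> \<bar>x\<bar>" unfolding a_def by linarith
      moreover have "K * ?b + a \<le> \<gamma> * q" using g(2) q by (simp add: field_simps)
      ultimately have "K * ?b \<le> \<bar>x\<bar>" by linarith
      then have "ennreal K \<le> ennreal \<bar>x\<bar> / ennreal (support_MAD P X u \<alpha>)"
        using K MAD0 by (intro ennreal_divide_ge[where b="?b"]) auto
      also have "\<dots> \<le> outlyingness P (fuzzy_add A (fuzzy_scale \<gamma> U)) X"
        unfolding x_def by (rule outlyingness_upper[OF u \<alpha>])
      finally show "ennreal K \<le> outlyingness P (fuzzy_add A (fuzzy_scale \<gamma> U)) X" .
    qed
  qed
qed

text \<open>
  The bound holds for non-integrable functions too, whose integral is \<open>0\<close> by convention. Upper bounds
  on the metrics can therefore be derived without discussing measurability of the integrand.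
\<close>

lemma set_lebesgue_integral_unit_interval_le:
  fixes f :: "real \<Rightarrow> real"
  assumes C: "0 \<le> C" and le: "\<And>x. x \<in> {0..1} \<Longrightarrow> f x \<le> C"
  shows "(LINT x:{0..1}|lborel. f x) \<le> C"
proof (cases "set_integrable lborel {0..1} f")
  case True
  have "(LINT x:{0..1}|lborel. f x) \<le> (LINT x:{0..1::real}|lborel. C)"
    by (intro set_integral_mono[OF True] le) (auto simp: set_integrable_def)
  then show ?thesis by (simp add: set_lebesgue_integral_def)
next
  case False
  then show ?thesis using C
    by (simp add: set_integrable_def set_lebesgue_integral_def not_integrable_integral_eq)
qed

lemma powr_inverse_le:
  assumes "x \<le> C powr r" "1 \<le> r" "0 \<le> (C::real)" "0 \<le> x"
  shows "x powr (1 / r) \<le> C"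
proof -
  have "x powr (1 / r) \<le> (C powr r) powr (1 / r)" using assms by (intro powr_mono2) auto
  then show ?thesis using assms by (simp add: powr_powr)
qed

text \<open>
  For \<open>d_metric\<close> and \<open>d_metric_inf\<close> the bound passes through the Hausdorff distance of levels, for
  \<open>rho_metric\<close> it applies to the integrand directly; the integrals are over
  probability measures, so they keep the bound.
\<close>

lemma metrics_le_support_fun_diff:
  assumes A: "A \<in> fuzzy_sets" and B: "B \<in> fuzzy_sets" and C: "0 \<le> C"
    and le: "\<And>u \<alpha>. norm u = 1 \<Longrightarrow> \<alpha> \<in> {0..1} \<Longrightarrow> \<bar>support_fun A u \<alpha> - support_fun B u \<alpha>\<bar> \<le> C"
    and d: "(\<exists>r\<ge>1. d = rho_metric r) \<or> (\<exists>r\<ge>1. d = d_metric r) \<or> d = d_metric_inf"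
  shows "d A B \<le> C"
proof -
  have H: "hausdorff_dist (level A \<alpha>) (level B \<alpha>) \<le> C" if "\<alpha> \<in> {0..1}" for \<alpha>
    using le that unfolding support_fun_eq
    by (intro hausdorff_le_set_support_diff fuzzy_set_level(4)[OF A] fuzzy_set_level(4)[OF B] C) auto
  have H0: "0 \<le> hausdorff_dist K L" for K L :: "(real^'a) set"
    by (rule Metric_space.nonneg[OF Metric_space_convex_bodies])
  interpret S: prob_space "sphere_measure :: (real^'a) measure" by (rule sphere_measure_prob_space)
  have sp: "space (sphere_measure :: (real^'a) measure) = sphere 0 1"
    by (simp add: sphere_measure_def space_restrict_space)
  from d consider (rho) r where "1 \<le> r" "d = rho_metric r" | (dr) r where "1 \<le> r" "d = d_metric r"
    | (dinf) "d = d_metric_inf" by blast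
  then show ?thesis
  proof cases
    case rho
    have inner: "(LINT u|sphere_measure. \<bar>support_fun A u \<alpha> - support_fun B u \<alpha>\<bar> powr r) \<le> C powr r"
      if "\<alpha> \<in> {0..1}" for \<alpha>
    proof (cases "integrable sphere_measure (\<lambda>u. \<bar>support_fun A u \<alpha> - support_fun B u \<alpha>\<bar> powr r)")
      case True
      have "(LINT u|sphere_measure. \<bar>support_fun A u \<alpha> - support_fun B u \<alpha>\<bar> powr r)
          \<le> (LINT u|(sphere_measure :: (real^'a) measure). C powr r)"
        using le that rho by (intro integral_mono[OF True]) (auto simp: sp intro!: powr_mono2)
      then show ?thesis by (simp add: S.prob_space)
    qed (simp add: not_integrable_integral_eq)
    show ?thesis unfolding rho rho_metric_def
      by (intro powr_inverse_le set_lebesgue_integral_unit_interval_le inner rho C)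
        (auto simp: set_lebesgue_integral_def intro!: Bochner_Integration.integral_nonneg)
  next
    case dr
    have "hausdorff_dist (level A \<alpha>) (level B \<alpha>) powr r \<le> C powr r" if "\<alpha> \<in> {0..1}" for \<alpha>
      using H[OF that] H0 dr by (intro powr_mono2) auto
    then show ?thesis unfolding dr d_metric_def
      by (intro powr_inverse_le set_lebesgue_integral_unit_interval_le dr C)
        (auto simp: set_lebesgue_integral_def intro!: Bochner_Integration.integral_nonneg)
  next
    case dinf
    then show ?thesis using H by (auto simp: d_metric_inf_def intro!: cSUP_least)
  qed
qed

text \<open>
  The pair \<open>(u, \<alpha>)\<close> at which the support functions of \<open>An n\<close> and \<open>A\<close> are far apart depends on \<open>n\<close>,
  so only bounds uniform in \<open>(u, \<alpha>)\<close> can be used for the median, the \<open>MAD\<close> and \<open>A\<close>.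
\<close>

lemma D_FP_divergent_tendsto_0:
  fixes X :: "'w \<Rightarrow> (real^'n) \<Rightarrow> real"
  assumes P: "prob_space P" and X: "X \<in> fuzzy_random_variables P"
    and A: "A \<in> fuzzy_sets" and An: "\<And>n. An n \<in> fuzzy_sets"
    and d: "(\<exists>r\<ge>1. d = rho_metric r) \<or> (\<exists>r\<ge>1. d = d_metric r) \<or> d = d_metric_inf"
    and lim: "filterlim (\<lambda>n. d (An n) A) at_top F"
  shows "((\<lambda>n. D_FP P (An n) X) \<longlongrightarrow> 0) F"
proof -
  obtain R where R: "0 < R" and m: "\<And>u \<alpha>. norm u = 1 \<Longrightarrow> \<alpha> \<in> {0..1} \<Longrightarrow> 
      \<bar>support_med P X u \<alpha>\<bar> \<le> R \<and> 0 \<le> support_MAD P X u \<alpha> \<and> support_MAD P X u \<alpha> \<le> R"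
    using support_med_MAD_uniformly_bounded[OF P X] by blast
  obtain RA where RA: "0 < RA" "\<And>\<alpha> v. \<alpha> \<in> {0..1} \<Longrightarrow> v \<in> level A \<alpha> \<Longrightarrow> norm v \<le> RA"
    using fuzzy_set_bounded[OF A] by blast
  show ?thesis
  proof (rule D_FP_tendsto_0)
    fix K :: real assume K: "0 < K"
    \<comment> \<open>\<open>R\<close> pays for the median and \<open>RA\<close> for \<open>A\<close>; what remains beats the spread \<open>K\<close> times.\<close>
    define C where "C = K * R + R + RA"
    have C: "0 \<le> C" using K R RA by (simp add: C_def)
    have "eventually (\<lambda>n. d (An n) A > C) F"
      using lim by (simp add: filterlim_at_top_dense)
    then show "\<forall>\<^sub>F n in F. ennreal K \<le> outlyingness P (An n) X"
    proof eventually_elim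
      case (elim n)
      then obtain u \<alpha> where u: "norm u = 1" and \<alpha>: "\<alpha> \<in> {0..1}"
          and big: "\<bar>support_fun (An n) u \<alpha> - support_fun A u \<alpha>\<bar> > C"
        using metrics_le_support_fun_diff[OF An A C _ d, of n] by (meson not_le)
      have "\<bar>support_fun A u \<alpha>\<bar> \<le> RA" using support_fun_bound[OF A \<alpha>, of RA u] RA(2)[OF \<alpha>] u by simp
      then have "K * R \<le> \<bar>support_fun (An n) u \<alpha> - support_med P X u \<alpha>\<bar>"
        using big m[OF u \<alpha>] unfolding C_def by linarith
      then have "ennreal K \<le> ennreal \<bar>support_fun (An n) u \<alpha> - support_med P X u \<alpha>\<bar> / ennreal (support_MAD P X u \<alpha>)"
        using m[OF u \<alpha>] K R by (intro ennreal_divide_ge[where b=R]) auto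
      also have "\<dots> \<le> outlyingness P (An n) X" by (rule outlyingness_upper[OF u \<alpha>])
      finally show ?case .
    qed
  qed
qed

section \<open>The equality case of Minkowski's inequality\<close>

text \<open>
  The function \<open>x powr r - r * x\<close> has its strict minimum at \<open>1\<close>; the mean value theorem is applied on
  either side of it.
\<close>

lemma bernoulli_powr_strict:
  fixes v r :: real
  assumes r: "1 < r" and v: "0 \<le> v" "v \<noteq> 1"
  shows "1 + r * (v - 1) < v powr r"
proof (cases "v = 0")
  case False
  define g where "g x = x powr r - r * x" for x
  have D: "(g has_real_derivative r * (x powr (r - 1) - 1)) (at x)" if "0 < x" for x
    unfolding g_def using that by (auto intro!: derivative_eq_intros simp: algebra_simps)
  have "g 1 < g v"
  proof (cases "1 < v")
    case True
    obtain z where z: "1 < z" "z < v" "g v - g 1 = (v - 1) * (r * (z powr (r - 1) - 1))"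
      using MVT2[OF True D] by auto
    have "1 < z powr (r - 1)" using z r by (simp add: gr_one_powr)
    then have "0 < (v - 1) * (r * (z powr (r - 1) - 1))" using True r by simp
    then show ?thesis using z by simp
  next
    case v1: False
    then have "v < 1" "0 < v" using v False by auto
    obtain z where z: "v < z" "z < 1" "g 1 - g v = (1 - v) * (r * (z powr (r - 1) - 1))"
      using MVT2[OF \<open>v < 1\<close> D] \<open>0 < v\<close> by auto
    have "z powr (r - 1) < 1 powr (r - 1)"
      using z r \<open>0 < v\<close> by (intro powr_less_mono2) auto
    then have "(1 - v) * (r * (z powr (r - 1) - 1)) < 0"
      using \<open>v < 1\<close> r by (simp add: mult_pos_neg)
    then show ?thesis using z by simp
  qed
  then show ?thesis by (simp add: g_def algebra_simps)
qed (use r in simp)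

text \<open>
  For \<open>z \<noteq> 0\<close>, after scaling by \<open>|z|\<close>, this is Bernoulli's inequality for \<open>v = |x| / |z|\<close>. That inequality is not
  strict when \<open>v = 1\<close>, but then \<open>x = - z\<close>, where the tangent has the value \<open>(1 - 2 r) |z|\<^sup>r\<close>.
\<close>

lemma abs_powr_above_tangent:
  fixes x z r :: real
  assumes r: "1 < r" and xz: "x \<noteq> z"
  shows "\<bar>z\<bar> powr r + r * \<bar>z\<bar> powr (r - 1) * sgn z * (x - z) < \<bar>x\<bar> powr r"
proof (cases "z = 0")
  case True
  then show ?thesis using xz by simp
next
  case False
  define v where "v = \<bar>x\<bar> / \<bar>z\<bar>"
  have x: "\<bar>x\<bar> = v * \<bar>z\<bar>" and v: "0 \<le> v" using False by (auto simp: v_def)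
  have pz: "\<bar>z\<bar> powr r = \<bar>z\<bar> powr (r - 1) * \<bar>z\<bar>" using False by (simp add: powr_diff)
  have "\<bar>z\<bar> powr r + r * \<bar>z\<bar> powr (r - 1) * sgn z * (x - z) =
      \<bar>z\<bar> powr r + r * \<bar>z\<bar> powr (r - 1) * (sgn z * x - \<bar>z\<bar>)"
    by (simp add: algebra_simps abs_sgn)
  also have "sgn z * x \<le> \<bar>x\<bar>" using False by (cases "z > 0") auto
  then have "\<bar>z\<bar> powr r + r * \<bar>z\<bar> powr (r - 1) * (sgn z * x - \<bar>z\<bar>)
      \<le> \<bar>z\<bar> powr r + r * \<bar>z\<bar> powr (r - 1) * (\<bar>x\<bar> - \<bar>z\<bar>)"
    using r by (intro add_left_mono mult_left_mono) auto
  also have "\<dots> = \<bar>z\<bar> powr r * (1 + r * (v - 1))"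
    unfolding pz x by (simp add: algebra_simps)
  finally have le: "\<bar>z\<bar> powr r + r * \<bar>z\<bar> powr (r - 1) * sgn z * (x - z) \<le> \<bar>z\<bar> powr r * (1 + r * (v - 1))" .
  have x': "\<bar>x\<bar> powr r = \<bar>z\<bar> powr r * v powr r" unfolding x using v by (simp add: powr_mult)
  show ?thesis
  proof (cases "v = 1")
    case True
    then have "x = - z" "\<bar>x\<bar> = \<bar>z\<bar>" using x xz by auto
    have "r * \<bar>z\<bar> powr (r - 1) * sgn z * (x - z) = - (2 * r * \<bar>z\<bar> powr (r - 1) * \<bar>z\<bar>)"
      unfolding \<open>x = - z\<close> by (simp add: abs_sgn)
    also have "\<dots> < 0" using False r by simp
    finally show ?thesis using \<open>\<bar>x\<bar> = \<bar>z\<bar>\<close> by simp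
  next
    case v1: False
    have "\<bar>z\<bar> powr r * (1 + r * (v - 1)) < \<bar>z\<bar> powr r * v powr r"
      using bernoulli_powr_strict[OF r v v1] False by (intro mult_strict_left_mono) auto
    with le show ?thesis unfolding x' by linarith
  qed
qed

text \<open>
  The tangent at the convex combination \<open>z\<close> lies strictly below the graph at both \<open>x\<close> and \<open>y\<close>.
\<close>

lemma abs_powr_strictly_convex:
  fixes x y t r :: real
  assumes r: "1 < r" and t: "0 < t" "t < 1" and xy: "x \<noteq> y"
  shows "\<bar>t * x + (1 - t) * y\<bar> powr r < t * \<bar>x\<bar> powr r + (1 - t) * \<bar>y\<bar> powr r"
proof -
  define z where "z = t * x + (1 - t) * y"
  define c where "c = r * \<bar>z\<bar> powr (r - 1) * sgn z"
  have "x - z = (1 - t) * (x - y)" "y - z = - t * (x - y)" by (simp_all add: z_def algebra_simps)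
  then have "x \<noteq> z" "y \<noteq> z" using t xy by auto
  then have "\<bar>z\<bar> powr r + c * (x - z) < \<bar>x\<bar> powr r" "\<bar>z\<bar> powr r + c * (y - z) < \<bar>y\<bar> powr r"
    unfolding c_def by (intro abs_powr_above_tangent r; simp)+
  then have "t * (\<bar>z\<bar> powr r + c * (x - z)) + (1 - t) * (\<bar>z\<bar> powr r + c * (y - z))
      < t * \<bar>x\<bar> powr r + (1 - t) * \<bar>y\<bar> powr r"
    using t by (intro add_strict_mono mult_strict_left_mono) auto
  moreover have "t * (\<bar>z\<bar> powr r + c * (x - z)) + (1 - t) * (\<bar>z\<bar> powr r + c * (y - z)) = \<bar>z\<bar> powr r"
    by (simp add: z_def algebra_simps)
  ultimately show ?thesis by (simp add: z_def)
qed

text \<open>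
  With \<open>a\<close> and \<open>b\<close> the norms of \<open>f\<close> and \<open>g\<close>, the normalized functions \<open>F = f / a\<close> and \<open>G = g / b\<close>
  satisfy the convexity inequality pointwise with weights \<open>a / (a + b)\<close> and \<open>b / (a + b)\<close>. Equality
  of the norms makes both sides integrate to \<open>1\<close>, so the inequality is an equality almost everywhere,
  and strict convexity gives \<open>F = G\<close>. The conclusion is stated as \<open>f = \<gamma> (f + g)\<close> to include the
  cases in which a norm vanishes.
\<close>

lemma minkowski_equality:
  fixes f g :: "'a \<Rightarrow> real"
  assumes r: "1 < r"
    and f: "integrable M (\<lambda>x. \<bar>f x\<bar> powr r)" and g: "integrable M (\<lambda>x. \<bar>g x\<bar> powr r)"
    and fg: "integrable M (\<lambda>x. \<bar>f x + g x\<bar> powr r)"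
    and eq: "(LINT x|M. \<bar>f x + g x\<bar> powr r) powr (1 / r) =
      (LINT x|M. \<bar>f x\<bar> powr r) powr (1 / r) + (LINT x|M. \<bar>g x\<bar> powr r) powr (1 / r)"
  shows "\<exists>\<gamma>\<in>{0..1}. AE x in M. f x = \<gamma> * (f x + g x)"
proof -
  define N where "N h = (LINT x|M. \<bar>h x\<bar> powr r) powr (1 / r)" for h :: "'a \<Rightarrow> real"
  have N_powr: "N h powr r = (LINT x|M. \<bar>h x\<bar> powr r)" for h
    using r by (simp add: N_def powr_powr Bochner_Integration.integral_nonneg)
  have N0: "0 \<le> N h" for h by (simp add: N_def)
  have zero: "AE x in M. h x = 0" if "N h = 0" "integrable M (\<lambda>x. \<bar>h x\<bar> powr r)" for h
  proof -
    have "(LINT x|M. \<bar>h x\<bar> powr r) = 0" using N_powr[of h] that by simp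
    then have "AE x in M. \<bar>h x\<bar> powr r = 0"
      using integral_nonneg_eq_0_iff_AE[OF that(2)] by simp
    then show ?thesis by simp
  qed
  define a b where "a = N f" and "b = N g"
  have sum: "N (\<lambda>x. f x + g x) = a + b" using eq by (simp add: N_def a_def b_def)
  show ?thesis
  proof (cases "a = 0 \<or> b = 0")
    case True
    then show ?thesis
    proof
      assume "a = 0"
      with zero[of f] f show ?thesis by (intro bexI[of _ 0]) (auto simp: a_def)
    next
      assume "b = 0"
      with zero[of g] g have "AE x in M. g x = 0" by (simp add: b_def)
      then show ?thesis by (intro bexI[of _ 1]) auto
    qed
  next
    case False
    then have a: "0 < a" and b: "0 < b" using N0[of f] N0[of g] by (auto simp: a_def b_def)
    define t where "t = a / (a + b)"
    have t: "0 < t" "t < 1" and t': "1 - t = b / (a + b)" using a b by (auto simp: t_def field_simps)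
    define F where "F x = f x / a" for x
    define G where "G x = g x / b" for x
    have F: "\<bar>F x\<bar> powr r = \<bar>f x\<bar> powr r / a powr r" for x
      using a by (simp add: F_def powr_divide)
    have G: "\<bar>G x\<bar> powr r = \<bar>g x\<bar> powr r / b powr r" for x
      using b by (simp add: G_def powr_divide)
    have tFG: "t * F x + (1 - t) * G x = (f x + g x) / (a + b)" for x
      unfolding t' using a b by (simp add: t_def F_def G_def add_divide_distrib)
    have FG: "\<bar>t * F x + (1 - t) * G x\<bar> powr r = \<bar>f x + g x\<bar> powr r / (a + b) powr r" for x
      unfolding tFG using a b by (simp add: powr_divide)
    define h where "h x = t * \<bar>F x\<bar> powr r + (1 - t) * \<bar>G x\<bar> powr r - \<bar>t * F x + (1 - t) * G x\<bar> powr r" for x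
    have h0: "0 \<le> h x" for x
    proof (cases "F x = G x")
      case True
      then show ?thesis by (simp add: h_def algebra_simps)
    next
      case False
      then show ?thesis using abs_powr_strictly_convex[OF r t False] by (simp add: h_def)
    qed
    have hi: "integrable M h" unfolding h_def F G FG using f g fg by auto
    have "integral\<^sup>L M h = t * ((LINT x|M. \<bar>f x\<bar> powr r) / a powr r) + (1 - t) * ((LINT x|M. \<bar>g x\<bar> powr r) / b powr r)
        - (LINT x|M. \<bar>f x + g x\<bar> powr r) / (a + b) powr r"
      unfolding h_def F G FG using f g fg by simp
    also have "\<dots> = 0"
      using a b unfolding N_powr[symmetric] sum a_def[symmetric] b_def[symmetric] by simp
    finally have "AE x in M. h x = 0" using integral_nonneg_eq_0_iff_AE[OF hi] h0 by simp
    then have "AE x in M. f x = t * (f x + g x)"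
    proof eventually_elim
      case (elim x)
      have "F x = G x"
      proof (rule ccontr)
        assume "F x \<noteq> G x"
        from abs_powr_strictly_convex[OF r t this] elim show False by (simp add: h_def)
      qed
      then have "F x = (f x + g x) / (a + b)" using tFG[of x] by (simp add: algebra_simps)
      then show ?case using a by (simp add: F_def t_def field_simps)
    qed
    then show ?thesis using t by (intro bexI[of _ t]) auto
  qed
qed

section \<open>Almost everywhere identities between support functions\<close>

lemma AE_lborel_meets_open:
  fixes S :: "'a::euclidean_space set"
  assumes S: "open S" "S \<noteq> {}" and AE: "AE x in lborel. x \<in> S \<longrightarrow> Q x"
  shows "\<exists>x\<in>S. Q x"
proof (rule ccontr)
  assume "\<not> (\<exists>x\<in>S. Q x)"
  with AE have "AE x in lborel. x \<notin> S" by auto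
  then have "S \<in> null_sets lborel" using S(1) by (simp add: AE_iff_null_sets)
  then have "negligible S" by (simp add: negligible_iff_null_sets null_sets_completionI)
  then show False using open_not_negligible S by blast
qed

text \<open>
  The measure has full support: the cone over a non-empty open subset of the sphere meets the unit
  ball in a set with non-empty interior.
\<close>

lemma AE_sphere_measure_continuous:
  fixes h :: "real^'n \<Rightarrow> real"
  assumes c: "continuous_on UNIV h" and AE: "AE u in sphere_measure. h u = 0" and w: "norm w = 1"
  shows "h w = 0"
proof (rule ccontr)
  assume "h w \<noteq> 0"
  let ?U = "uniform_measure lborel (ball 0 1) :: (real^'n) measure"
  have sgn_m[measurable]: "sgn \<in> borel_measurable (borel :: (real^'n) measure)"
    unfolding sgn_div_norm by measurable
  have h_m[measurable]: "h \<in> borel_measurable borel" using c by (rule borel_measurable_continuous_onI)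
  have ball: "ball 0 1 \<in> sets (lborel :: (real^'n) measure)" by simp
  have "AE u in distr ?U borel sgn. u \<in> sphere 0 1 \<longrightarrow> h u = 0"
    using AE unfolding sphere_measure_def by (subst (asm) AE_restrict_space_iff) auto
  then have "AE x in ?U. sgn x \<in> sphere 0 1 \<longrightarrow> h (sgn x) = 0"
    by (subst (asm) AE_distr_iff) auto
  then have "AE x in lborel. x \<in> ball 0 1 \<longrightarrow> sgn x \<in> sphere 0 1 \<longrightarrow> h (sgn x) = 0"
    using unit_ball_vol_pos[of "real CARD('n)"] emeasure_lborel_ball_finite[of "0::real^'n" 1]
    by (subst (asm) AE_uniform_measure) (auto simp: emeasure_ball simp del: unit_ball_vol_pos)
  define S where "S = {x \<in> ball 0 1 - {0}. h (sgn x) \<noteq> 0}"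
  have "continuous_on (ball 0 1 - {0}) (\<lambda>x. h (sgn x))"
    unfolding sgn_div_norm
    by (intro continuous_on_compose2[OF c] continuous_intros) auto
  then have "open S" unfolding S_def
    using continuous_open_preimage[of "ball 0 1 - {0}" "\<lambda>x. h (sgn x)" "- {0}"]
    by (auto simp: vimage_def Int_def open_Diff)
  \<comment> \<open>\<open>w\<close> itself lies on the boundary of the ball.\<close>
  moreover have "w /\<^sub>R 2 \<in> S" using w \<open>h w \<noteq> 0\<close> by (auto simp: S_def sgn_div_norm)
  moreover have "AE x in lborel. x \<in> S \<longrightarrow> False"
    using \<open>AE x in lborel. x \<in> ball 0 1 \<longrightarrow> sgn x \<in> sphere 0 1 \<longrightarrow> h (sgn x) = 0\<close>
    by eventually_elim (auto simp: S_def norm_sgn split: if_splits)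
  ultimately show False using AE_lborel_meets_open[of S "\<lambda>_. False"] by blast
qed

abbreviation unit_interval_measure :: "real measure" where
  "unit_interval_measure \<equiv> restrict_space lborel {0..1}"

lemma prob_space_unit_interval: "prob_space unit_interval_measure"
  by (intro prob_spaceI) (simp add: space_restrict_space emeasure_restrict_space)

text \<open>
  By Lipschitz continuity in the direction, the support function is the supremum over a countable
  dense set of \<open>q\<close> of \<open>support_fun A q \<alpha> - R |u - q|\<close>. Each of these is measurable, being a monotone
  function of \<open>\<alpha>\<close> minus a continuous function of \<open>u\<close>.
\<close>

lemma support_fun_jointly_measurable:
  fixes A :: "real^'n \<Rightarrow> real"
  assumes A: "A \<in> fuzzy_sets"
  shows "(\<lambda>p. support_fun A (snd p) (fst p)) \<in>
    borel_measurable (unit_interval_measure \<Otimes>\<^sub>M (sphere_measure :: (real^'n) measure))"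
proof -
  let ?M = "unit_interval_measure \<Otimes>\<^sub>M (sphere_measure :: (real^'n) measure)"
  obtain R where R: "0 < R" "\<And>\<alpha> v. \<alpha> \<in> {0..1} \<Longrightarrow> v \<in> level A \<alpha> \<Longrightarrow> norm v \<le> R"
    using fuzzy_set_bounded[OF A] by blast
  obtain D :: "(real^'n) set" where D: "countable D" "\<And>X. open X \<Longrightarrow> X \<noteq> {} \<Longrightarrow> \<exists>d\<in>D. d \<in> X"
    using countable_dense_setE by metis
  let ?F = "\<lambda>q p. support_fun A q (fst p) - R * norm (snd p - q)"
  have lip: "\<bar>support_fun A u \<alpha> - support_fun A q \<alpha>\<bar> \<le> R * norm (u - q)" if "\<alpha> \<in> {0..1}" for u q \<alpha>
    using support_fun_lipschitz[OF A that] R(2)[OF that] by blast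
  have sp: "fst p \<in> {0..1}" if "p \<in> space ?M" for p
    using that by (auto simp: space_pair_measure space_restrict_space)
  have le: "?F q p \<le> support_fun A (snd p) (fst p)" if "p \<in> space ?M" for q p
    using lip[OF sp[OF that], of "snd p" q] by linarith
  have D0: "D \<noteq> {}" using D(2)[of UNIV] by auto
  have bdd: "bdd_above ((\<lambda>q. ?F q p) ` D)" if "p \<in> space ?M" for p
    using le[OF that] by (intro bdd_aboveI2)
  have eq: "support_fun A (snd p) (fst p) = (SUP q\<in>D. ?F q p)" if p: "p \<in> space ?M" for p
  proof (rule antisym)
    show "(SUP q\<in>D. ?F q p) \<le> support_fun A (snd p) (fst p)"
      using le[OF p] D0 by (intro cSUP_least) auto
    show "support_fun A (snd p) (fst p) \<le> (SUP q\<in>D. ?F q p)"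
    proof (rule field_le_epsilon)
      fix e :: real assume e: "0 < e"
      \<comment> \<open>The distance to \<open>q\<close> is paid twice: in the subtracted term and in the Lipschitz estimate.\<close>
      obtain q where q: "q \<in> D" "q \<in> ball (snd p) (e / (2 * R))"
        using D(2)[of "ball (snd p) (e / (2 * R))"] e R(1) by (auto simp: not_le)
      have "R * norm (snd p - q) \<le> R * (e / (2 * R))"
        using q R by (intro mult_left_mono) (auto simp: dist_norm)
      then have "2 * (R * norm (snd p - q)) \<le> e" using R by simp
      then have "support_fun A (snd p) (fst p) \<le> ?F q p + e"
        using lip[OF sp[OF p], of "snd p" q] by linarith
      also have "?F q p \<le> (SUP q\<in>D. ?F q p)" by (rule cSUP_upper[OF q(1) bdd[OF p]])
      finally show "support_fun A (snd p) (fst p) \<le> (SUP q\<in>D. ?F q p) + e" by simp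
    qed
  qed
  have F: "?F q \<in> borel_measurable ?M" for q
  proof -
    have "mono_on {0..1} (\<lambda>\<alpha>. - support_fun A q \<alpha>)"
      using support_fun_antimono[OF A] by (intro mono_onI) auto
    from borel_measurable_mono_on_fnc[OF this]
    have "(\<lambda>\<alpha>. - (- support_fun A q \<alpha>)) \<in> borel_measurable (restrict_space borel {0..1})"
      by (rule borel_measurable_uminus)
    then have 1: "support_fun A q \<in> borel_measurable unit_interval_measure"
      by (simp cong: measurable_cong_sets add: sets_restrict_space_cong[of lborel borel])
    have 2: "(\<lambda>u. norm (u - q)) \<in> borel_measurable (sphere_measure :: (real^'n) measure)"
      unfolding sphere_measure_def by (rule measurable_restrict_space1) simp
    show ?thesis
      by (intro borel_measurable_diff borel_measurable_times borel_measurable_const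
          measurable_compose[OF measurable_fst 1] measurable_compose[OF measurable_snd 2])
  qed
  have "(\<lambda>p. SUP q\<in>D. ?F q p) \<in> borel_measurable ?M"
    by (intro borel_measurable_cSUP D(1) F bdd)
  then show ?thesis using eq by (simp cong: measurable_cong)
qed

text \<open>
  The iterated integral is an integral over a product probability space, since the integrand is
  bounded and jointly measurable.
\<close>

lemma rho_metric_eq:
  fixes A B :: "real^'n \<Rightarrow> real"
  assumes A: "A \<in> fuzzy_sets" and B: "B \<in> fuzzy_sets" and r: "1 \<le> r"
  defines "M \<equiv> unit_interval_measure \<Otimes>\<^sub>M (sphere_measure :: (real^'n) measure)"
  defines "f \<equiv> \<lambda>p. \<bar>support_fun A (snd p) (fst p) - support_fun B (snd p) (fst p)\<bar> powr r"
  shows "integrable M f" "rho_metric r A B = (LINT p|M. f p) powr (1 / r)"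
proof -
  interpret I: prob_space unit_interval_measure by (rule prob_space_unit_interval)
  interpret S: prob_space "sphere_measure :: (real^'n) measure" by (rule sphere_measure_prob_space)
  interpret IS: pair_prob_space unit_interval_measure "sphere_measure :: (real^'n) measure" ..
  obtain RA where RA: "0 < RA" "\<And>\<alpha> v. \<alpha> \<in> {0..1} \<Longrightarrow> v \<in> level A \<alpha> \<Longrightarrow> norm v \<le> RA"
    using fuzzy_set_bounded[OF A] by blast
  obtain RB where RB: "0 < RB" "\<And>\<alpha> v. \<alpha> \<in> {0..1} \<Longrightarrow> v \<in> level B \<alpha> \<Longrightarrow> norm v \<le> RB"
    using fuzzy_set_bounded[OF B] by blast
  have bound: "norm (f p) \<le> (RA + RB) powr r" if "p \<in> space M" for p
  proof -
    have p: "fst p \<in> {0..1}" "norm (snd p) = 1"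
      using that by (auto simp: M_def space_pair_measure space_restrict_space sphere_measure_def)
    have "\<bar>support_fun A (snd p) (fst p)\<bar> \<le> RA" "\<bar>support_fun B (snd p) (fst p)\<bar> \<le> RB"
      using support_fun_bound[OF A p(1), of RA "snd p"] support_fun_bound[OF B p(1), of RB "snd p"]
        RA(2)[OF p(1)] RB(2)[OF p(1)] p(2) by auto
    then show ?thesis unfolding f_def using r by (auto intro!: powr_mono2)
  qed
  have "f \<in> borel_measurable M"
    unfolding f_def M_def
    by (intro powr_real_measurable borel_measurable_abs borel_measurable_diff borel_measurable_const
        support_fun_jointly_measurable A B)
  then show int: "integrable M f"
    using bound unfolding M_def by (intro IS.P.integrable_const_bound[where B="(RA + RB) powr r"]) auto
  have "(LINT p|M. f p) = (LINT \<alpha>|unit_interval_measure. (LINT u|sphere_measure. f (\<alpha>, u)))"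
    using IS.integral_fst'[of f] int by (simp add: M_def)
  also have "\<dots> = (LINT \<alpha>:{0..1}|lborel. (LINT u|sphere_measure. f (\<alpha>, u)))"
    by (subst integral_restrict_space) (auto simp: set_lebesgue_integral_def)
  finally show "rho_metric r A B = (LINT p|M. f p) powr (1 / r)"
    by (simp add: rho_metric_def f_def)
qed

text \<open>
  The equality case of Minkowski's inequality for \<open>s\<^sub>A - s\<^sub>U\<close> and \<open>s\<^sub>U - s\<^sub>V\<close> gives the identity
  almost everywhere. For almost every \<open>\<alpha>\<close> it holds for all \<open>u\<close> by continuity in \<open>u\<close>; these \<open>\<alpha>\<close> are
  dense, so one-sided continuity in \<open>\<alpha>\<close> gives all of them.
\<close>

lemma rho_metric_between:
  fixes A U V :: "real^'n \<Rightarrow> real"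
  assumes A: "A \<in> fuzzy_sets" and U: "U \<in> fuzzy_sets" and V: "V \<in> fuzzy_sets" and r: "1 < r"
    and eq: "rho_metric r A V = rho_metric r A U + rho_metric r U V"
  shows "\<exists>\<gamma>\<in>{0..1}. \<forall>u \<alpha>. norm u = 1 \<longrightarrow> \<alpha> \<in> {0..1} \<longrightarrow>
    support_fun U u \<alpha> = (1 - \<gamma>) * support_fun A u \<alpha> + \<gamma> * support_fun V u \<alpha>"
proof -
  interpret I: prob_space unit_interval_measure by (rule prob_space_unit_interval)
  interpret S: prob_space "sphere_measure :: (real^'n) measure" by (rule sphere_measure_prob_space)
  interpret IS: pair_prob_space unit_interval_measure "sphere_measure :: (real^'n) measure" ..
  let ?M = "unit_interval_measure \<Otimes>\<^sub>M (sphere_measure :: (real^'n) measure)"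
  let ?f = "\<lambda>p. support_fun A (snd p) (fst p) - support_fun U (snd p) (fst p)"
  let ?g = "\<lambda>p. support_fun U (snd p) (fst p) - support_fun V (snd p) (fst p)"
  have r1: "1 \<le> r" using r by simp
  have sum: "?f p + ?g p = support_fun A (snd p) (fst p) - support_fun V (snd p) (fst p)" for p by simp
  have "\<exists>\<gamma>\<in>{0..1}. AE p in ?M. ?f p = \<gamma> * (?f p + ?g p)"
    using rho_metric_eq[OF A U r1] rho_metric_eq[OF U V r1] rho_metric_eq[OF A V r1] eq
    by (intro minkowski_equality[OF r]) (simp_all only: sum)
  then obtain \<gamma> where g: "\<gamma> \<in> {0..1}" and AE: "AE p in ?M. ?f p = \<gamma> * (?f p + ?g p)" by blast
  define h where
    "h u \<alpha> = support_fun U u \<alpha> - ((1 - \<gamma>) * support_fun A u \<alpha> + \<gamma> * support_fun V u \<alpha>)" for u \<alpha>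
  have "AE p in ?M. h (snd p) (fst p) = 0"
    using AE by eventually_elim (simp add: h_def algebra_simps)
  from IS.AE_pair[OF this]
  have "AE \<alpha> in unit_interval_measure. AE u in sphere_measure. h u \<alpha> = 0" by simp
  then have "AE \<alpha> in lborel. \<alpha> \<in> {0..1} \<longrightarrow> (AE u in sphere_measure. h u \<alpha> = 0)"
    by (subst (asm) AE_restrict_space_iff) auto
  then have ae: "AE \<alpha> in lborel. \<alpha> \<in> {0..1} \<longrightarrow> (\<forall>u. norm u = 1 \<longrightarrow> h u \<alpha> = 0)"
  proof eventually_elim
    case (elim \<alpha>)
    show ?case
    proof (intro impI allI)
      fix u :: "real^'n" assume \<alpha>: "\<alpha> \<in> {0..1}" and u: "norm u = 1"
      have "continuous_on UNIV (\<lambda>u. h u \<alpha>)"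
        unfolding h_def
        by (intro continuous_intros support_fun_continuous[OF A \<alpha>] support_fun_continuous[OF U \<alpha>]
            support_fun_continuous[OF V \<alpha>])
      from AE_sphere_measure_continuous[OF this _ u] elim \<alpha> show "h u \<alpha> = 0" by blast
    qed
  qed
  have dense: "\<exists>\<beta>\<in>{a<..<b}. \<forall>u. norm u = 1 \<longrightarrow> h u \<beta> = 0" if "0 \<le> a" "a < b" "b \<le> 1" for a b
  proof (rule AE_lborel_meets_open)
    show "AE \<beta> in lborel. \<beta> \<in> {a<..<b} \<longrightarrow> (\<forall>u. norm u = 1 \<longrightarrow> h u \<beta> = 0)"
      using ae by eventually_elim (use that in auto)
  qed (use that in auto)
  have zero: "h u \<alpha> = 0" if u: "norm u = 1" and \<alpha>: "\<alpha> \<in> {0..1}" for u \<alpha>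
  proof (rule ccontr)
    assume nz: "h u \<alpha> \<noteq> 0"
    show False
    proof (cases "\<alpha> = 0")
      case True
      have "(h u \<longlongrightarrow> h u 0) (at_right 0)"
        unfolding h_def by (intro tendsto_intros support_fun_right_continuous_at_0 A U V)
      then have "\<forall>\<^sub>F \<beta> in at_right 0. h u \<beta> \<noteq> 0"
        by (rule tendsto_imp_eventually_ne) (use nz True in simp)
      then obtain b where b: "0 < b" "\<And>\<beta>. 0 < \<beta> \<Longrightarrow> \<beta> < b \<Longrightarrow> h u \<beta> \<noteq> 0"
        by (auto simp: eventually_at_right_field)
      with dense[of 0 "min b 1"] u show False by auto
    next
      case False
      with \<alpha> have "0 < \<alpha>" "\<alpha> \<le> 1" by auto
      then have "(h u \<longlongrightarrow> h u \<alpha>) (at_left \<alpha>)"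
        unfolding h_def by (intro tendsto_intros support_fun_left_continuous A U V)
      then have "\<forall>\<^sub>F \<beta> in at_left \<alpha>. h u \<beta> \<noteq> 0"
        by (rule tendsto_imp_eventually_ne) (rule nz)
      then obtain b where b: "b < \<alpha>" "\<And>\<beta>. b < \<beta> \<Longrightarrow> \<beta> < \<alpha> \<Longrightarrow> h u \<beta> \<noteq> 0"
        by (auto simp: eventually_at_left_field)
      with dense[of "max b 0" \<alpha>] u \<open>0 < \<alpha>\<close> \<open>\<alpha> \<le> 1\<close> show False by auto
    qed
  qed
  show ?thesis using g zero by (intro bexI[of _ \<gamma>]) (auto simp: h_def)
qed

section \<open>Properties of the projection depth\<close>

theorem theorem3p3:
  fixes P :: "'w measure"
  assumes "prob_space P"
  shows
    "(\<forall>(M :: real^'n^'n) U V X.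
        invertible M \<and> U \<in> fuzzy_sets \<and> V \<in> fuzzy_sets \<and> X \<in> fuzzy_random_variables P \<longrightarrow>
        D_FP P (fuzzy_add (fuzzy_matrix M U) V) (\<lambda>\<omega>. fuzzy_add (fuzzy_matrix M (X \<omega>)) V)
          = D_FP P U X)
     \<and>
     (\<forall>(X :: 'w \<Rightarrow> (real^'n) \<Rightarrow> real) U.
        X \<in> fuzzy_random_variables P \<and> U \<in> fuzzy_sets \<and> F_symmetric P X U \<longrightarrow>
        D_FP P U X = (SUP B\<in>fuzzy_sets. D_FP P B X))
     \<and>
     (\<forall>(X :: 'w \<Rightarrow> (real^'n) \<Rightarrow> real) A.
        X \<in> fuzzy_random_variables P \<and> A \<in> fuzzy_sets \<and>
        D_FP P A X = (SUP B\<in>fuzzy_sets. D_FP P B X) \<longrightarrow>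
          (\<forall>\<gamma>\<in>{0..1}. \<forall>U\<in>fuzzy_sets.
             D_FP P A X \<ge> D_FP P (fuzzy_add (fuzzy_scale (1 - \<gamma>) A) (fuzzy_scale \<gamma> U)) X \<and>
             D_FP P (fuzzy_add (fuzzy_scale (1 - \<gamma>) A) (fuzzy_scale \<gamma> U)) X \<ge> D_FP P U X)
        \<and> (\<forall>U\<in>fuzzy_sets - {indicator {0}}.
             ((\<lambda>\<gamma>. D_FP P (fuzzy_add A (fuzzy_scale \<gamma> U)) X) \<longlongrightarrow> 0) at_top)
        \<and> (\<forall>r>1. \<forall>U\<in>fuzzy_sets. \<forall>V\<in>fuzzy_sets.
             rho_metric r A V = rho_metric r A U + rho_metric r U V \<longrightarrow>
             D_FP P A X \<ge> D_FP P U X \<and> D_FP P U X \<ge> D_FP P V X)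
        \<and> (\<forall>d. (\<exists>r\<ge>1. d = rho_metric r) \<or> (\<exists>r\<ge>1. d = d_metric r) \<or> d = d_metric_inf \<longrightarrow>
             (\<forall>An. (\<forall>n. An n \<in> fuzzy_sets) \<and> filterlim (\<lambda>n. d (An n) A) at_top sequentially \<longrightarrow>
                (\<lambda>n. D_FP P (An n) X) \<longlonglongrightarrow> 0)))"
proof (intro conjI allI impI)
  interpret prob_space P by (rule assms)
  fix M :: "real^'n^'n" and U V :: "real^'n \<Rightarrow> real" and X :: "'w \<Rightarrow> (real^'n) \<Rightarrow> real"
  assume "invertible M \<and> U \<in> fuzzy_sets \<and> V \<in> fuzzy_sets \<and> X \<in> fuzzy_random_variables P"
  then show "D_FP P (fuzzy_add (fuzzy_matrix M U) V) (\<lambda>\<omega>. fuzzy_add (fuzzy_matrix M (X \<omega>)) V) = D_FP P U X"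
    using outlyingness_affine[OF assms, of M U V X] by (simp add: D_FP_def)
next
  fix X :: "'w \<Rightarrow> (real^'n) \<Rightarrow> real" and U
  assume H: "X \<in> fuzzy_random_variables P \<and> U \<in> fuzzy_sets \<and> F_symmetric P X U"
  then have "D_FP P U X = 1" using outlyingness_symmetric[OF assms, of X U] by (simp add: D_FP_def)
  moreover have "(SUP B\<in>fuzzy_sets. D_FP P B X) \<le> 1"
    using H D_FP_bounds(2) by (intro cSUP_least) auto
  moreover have "D_FP P U X \<le> (SUP B\<in>fuzzy_sets. D_FP P B X)"
    using H by (intro cSUP_upper bdd_above_D_FP) auto
  ultimately show "D_FP P U X = (SUP B\<in>fuzzy_sets. D_FP P B X)" by simp
next
  fix X :: "'w \<Rightarrow> (real^'n) \<Rightarrow> real" and A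
  assume H: "X \<in> fuzzy_random_variables P \<and> A \<in> fuzzy_sets \<and>
    D_FP P A X = (SUP B\<in>fuzzy_sets. D_FP P B X)"
  then have X: "X \<in> fuzzy_random_variables P" and A: "A \<in> fuzzy_sets" by auto
  have max: "D_FP P B X \<le> D_FP P A X" if "B \<in> fuzzy_sets" for B
    using H that by (metis cSUP_upper bdd_above_D_FP)
  have between: "D_FP P B X \<le> D_FP P C X"
    if B: "B \<in> fuzzy_sets" and g: "\<gamma> \<in> {0..1}" and C: "\<And>u \<alpha>. norm u = 1 \<Longrightarrow> \<alpha> \<in> {0..1} \<Longrightarrow>
      support_fun C u \<alpha> = (1 - \<gamma>) * support_fun A u \<alpha> + \<gamma> * support_fun B u \<alpha>" for B C \<gamma>
  proof -
    have "outlyingness P A X \<le> outlyingness P B X" using max[OF B] by (simp add: D_FP_le_iff)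
    then show ?thesis
      using outlyingness_between[OF g C, where P=P and X=X] by (simp add: D_FP_le_iff max_absorb2)
  qed
  {
    show "\<forall>\<gamma>\<in>{0..1}. \<forall>U\<in>fuzzy_sets.
        D_FP P A X \<ge> D_FP P (fuzzy_add (fuzzy_scale (1 - \<gamma>) A) (fuzzy_scale \<gamma> U)) X \<and>
        D_FP P (fuzzy_add (fuzzy_scale (1 - \<gamma>) A) (fuzzy_scale \<gamma> U)) X \<ge> D_FP P U X"
    proof (intro ballI)
      fix \<gamma> :: real and U :: "real^'n \<Rightarrow> real" assume g: "\<gamma> \<in> {0..1}" and U: "U \<in> fuzzy_sets"
      have scale: "fuzzy_scale c B \<in> fuzzy_sets" if "B \<in> fuzzy_sets" for c and B :: "real^'n \<Rightarrow> real"
        unfolding fuzzy_scale_eq_zadeh by (rule zadeh_linear_fuzzy_set[OF that linear_scale_self])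
      let ?C = "fuzzy_add (fuzzy_scale (1 - \<gamma>) A) (fuzzy_scale \<gamma> U)"
      have "?C \<in> fuzzy_sets" by (intro fuzzy_add_fuzzy_set scale A U)
      moreover have "support_fun ?C u \<alpha> = (1 - \<gamma>) * support_fun A u \<alpha> + \<gamma> * support_fun U u \<alpha>"
        if "\<alpha> \<in> {0..1}" for u \<alpha>
        using g by (simp add: support_fun_fuzzy_add[OF scale[OF A] scale[OF U] that]
            support_fun_fuzzy_scale[OF A that] support_fun_fuzzy_scale[OF U that])
      ultimately show "D_FP P A X \<ge> D_FP P ?C X \<and> D_FP P ?C X \<ge> D_FP P U X"
        using max between[OF U g] by blast
    qed
  next
    show "\<forall>U\<in>fuzzy_sets - {indicator {0}}.
        ((\<lambda>\<gamma>. D_FP P (fuzzy_add A (fuzzy_scale \<gamma> U)) X) \<longlongrightarrow> 0) at_top"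
      using D_FP_ray_tendsto_0[OF assms X A] by simp
  next
    fix r :: real assume r: "1 < r"
    show "\<forall>U\<in>fuzzy_sets. \<forall>V\<in>fuzzy_sets.
        rho_metric r A V = rho_metric r A U + rho_metric r U V \<longrightarrow>
        D_FP P A X \<ge> D_FP P U X \<and> D_FP P U X \<ge> D_FP P V X"
    proof (intro ballI impI)
      fix U V :: "real^'n \<Rightarrow> real"
      assume U: "U \<in> fuzzy_sets" and V: "V \<in> fuzzy_sets"
        and "rho_metric r A V = rho_metric r A U + rho_metric r U V"
      from rho_metric_between[OF A U V r this(3)] obtain \<gamma> where "\<gamma> \<in> {0..1}"
        "\<And>u \<alpha>. norm u = 1 \<Longrightarrow> \<alpha> \<in> {0..1} \<Longrightarrow>
          support_fun U u \<alpha> = (1 - \<gamma>) * support_fun A u \<alpha> + \<gamma> * support_fun V u \<alpha>" by blast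
      from between[OF V this] max[OF U] show "D_FP P A X \<ge> D_FP P U X \<and> D_FP P U X \<ge> D_FP P V X" by simp
    qed
  next
    fix d :: "(real^'n \<Rightarrow> real) \<Rightarrow> (real^'n \<Rightarrow> real) \<Rightarrow> real" and An
    assume "(\<exists>r\<ge>1. d = rho_metric r) \<or> (\<exists>r\<ge>1. d = d_metric r) \<or> d = d_metric_inf"
      and "(\<forall>n. An n \<in> fuzzy_sets) \<and> filterlim (\<lambda>n. d (An n) A) at_top sequentially"
    then show "(\<lambda>n. D_FP P (An n) X) \<longlonglongrightarrow> 0"
      by (intro D_FP_divergent_tendsto_0[OF assms X A]) auto
  }
qed

end
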